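(* Let $G$ be a digraph with vertex set $\{1,2,\dots,n\}$, let $H_1,\dots,H_n$ be digraphs with $|V(H_i)|=m_i$ for $1\le i\le n$, let $\overrightarrow{G}=G[H_1,H_2,\dots,H_n]$ be their generalized join digraph with respect to $G$, and let $i^*\in V(G)$. Then $$\sum_{u^*\in V(H_{i^*})}t_{u^*}(\overrightarrow{G})=\prod_{i\in V(G)}\prod_{k=1}^{m_i-1}\left(\mu_k(H_i)+\sum_{j:\,(i,j)\in E(G)}m_j\right)\cdot\sum_{T\in\mathcal{T}_{i^*}(G)}\ \prod_{(i,j)\in E(T)}m_j .$$
   Context: Digraphs are finite, with nonempty vertex set, without loops or multiple edges (both $(u,v)$ and $(v,u)$ may be edges); $(u,v)$ is an edge directed from tail $u$ to head $v$. Generalized join digraph: $G[H_1,\dots,H_n]$ is obtained from $G$ by replacing each vertex $i$ with $H_i$: its vertex set is the disjoint union $V(H_1)\cup\dots\cup V(H_n)$, the edges inside each $H_i$ are kept, and for $i\ne j$, $u\in V(H_i)$, $v\in V(H_j)$, $(u,v)$ is an edge if and only if $(i,j)\in E(G)$. Oriented spanning tree: an oriented spanning tree of a digraph is a subtree containing all its vertices, in which one vertex, the root, has outdegree $0$ and every other vertex has outdegree $1$ (so all edges point towards the root). $\mathcal{T}_v(G)$ is the set of oriented spanning trees of $G$ with root $v$, and $t_v(G)=|\mathcal{T}_v(G)|$. Laplacian: for an unweighted digraph $H$, $L_H$ is the matrix with $(L_H)_{uu}=$ the outdegree of $u$, $(L_H)_{uv}=-1$ if $(u,v)\in E(H)$,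 and $0$ otherwise. The Laplacian eigenvalues $\mu_1(H),\dots,\mu_m(H)$ ($m=|V(H)|$) are the complex eigenvalues of $L_H$ with algebraic multiplicity; since all row sums of $L_H$ are $0$, $0$ is an eigenvalue, and the numbering is such that $\mu_m(H)=0$. Empty products equal $1$. *)

theory Defs
  imports
    Complex_Main
    "Graph_Theory.Graph_Theory"
    "Jordan_Normal_Form.Char_Poly"
begin

text \<open>
  Digraphs are records of type \<open>'a pair_pre_digraph\<close>; the locale \<open>pair_digraph\<close> says that such a
  record is a finite digraph without loops (multiple edges are impossible, antiparallel ones are not).
  The locale admits the empty digraph, so nonemptiness of the vertex set is added here.
\<close>

definition nonempty_digraph :: "'a pair_pre_digraph \<Rightarrow> bool" where
  "nonempty_digraph G \<longleftrightarrow> pair_digraph G \<and> pverts G \<noteq> {}"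

text \<open>The disjoint union is realised by tagging a vertex \<open>u\<close> of \<open>H i\<close> as \<open>(i, u)\<close>.\<close>

definition generalized_join ::
    "'i pair_pre_digraph \<Rightarrow> ('i \<Rightarrow> 'a pair_pre_digraph) \<Rightarrow> ('i \<times> 'a) pair_pre_digraph" where
  "generalized_join G H =
    \<lparr> pverts = (SIGMA i : pverts G. pverts (H i)),
      parcs = {((i, u), (j, v)) | i u j v.
        i \<in> pverts G \<and> j \<in> pverts G \<and> u \<in> pverts (H i) \<and> v \<in> pverts (H j) \<and>
        (if i = j then (u, v) \<in> parcs (H i) else (i, j) \<in> parcs G)} \<rparr>"

text \<open>
  The library notion \<open>spanning_tree T G\<close> asks that \<open>T\<close> is a spanning subgraph of \<open>G\<close> whose underlying
  graph is connected and that \<open>T\<close> has no directed cycle; by itself this does not exclude undirected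
  cycles. The outdegree conditions do: they force \<open>T\<close> to have one edge less than vertices, so
  that the connected underlying graph is a tree and no two edges of \<open>T\<close> are antiparallel.
\<close>

definition oriented_spanning_trees :: "'a pair_pre_digraph \<Rightarrow> 'a \<Rightarrow> 'a pair_pre_digraph set" where
  "oriented_spanning_trees G r =
    {T. spanning_tree (with_proj T) (with_proj G) \<and> r \<in> pverts T \<and>
        out_degree (with_proj T) r = 0 \<and>
        (\<forall>v \<in> pverts T - {r}. out_degree (with_proj T) v = 1)}"

definition num_oriented_spanning_trees :: "'a pair_pre_digraph \<Rightarrow> 'a \<Rightarrow> nat" where
  "num_oriented_spanning_trees G r = card (oriented_spanning_trees G r)"

text \<open>
  Matrices are indexed by natural numbers, so the Laplacian is written down with respect to some
  enumeration of the vertices. Another enumeration gives a permutation-similar matrix, hence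
  the same characteristic polynomial.
\<close>

definition vertex_enum :: "'a pair_pre_digraph \<Rightarrow> 'a list" where
  "vertex_enum H = (SOME vs. distinct vs \<and> set vs = pverts H)"

definition laplacian_entry :: "'a pair_pre_digraph \<Rightarrow> 'a \<Rightarrow> 'a \<Rightarrow> complex" where
  "laplacian_entry H u v =
    (if u = v then of_nat (out_degree (with_proj H) u)
     else if (u, v) \<in> parcs H then -1 else 0)"

definition laplacian :: "'a pair_pre_digraph \<Rightarrow> complex mat" where
  "laplacian H = mat (card (pverts H)) (card (pverts H))
    (\<lambda>(a, b). laplacian_entry H (vertex_enum H ! a) (vertex_enum H ! b))"

text \<open>
  \<open>\<mu> 1, \<dots>, \<mu> m\<close> (with \<open>m\<close> the number of vertices) lists the eigenvalues of the Laplacian, each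
  as often as its algebraic multiplicity, with a zero eigenvalue in the last place.
\<close>

definition laplacian_eigenvalues :: "'a pair_pre_digraph \<Rightarrow> (nat \<Rightarrow> complex) \<Rightarrow> bool" where
  "laplacian_eigenvalues H \<mu> \<longleftrightarrow>
    (\<forall>z. card {k \<in> {1..card (pverts H)}. \<mu> k = z} = Polynomial.order z (char_poly (laplacian H))) \<and>
    \<mu> (card (pverts H)) = 0"

end

theory Submission
  imports Defs
begin

text \<open>
  Every vertex of block \<open>i\<close> of the join sees the vertices outside its block in the same way, so the
  Laplacian of the join is a block diagonal matrix, with blocks \<open>L\<^sub>i + d\<^sub>i\<close> where \<open>L\<^sub>i\<close> is the Laplacian
  of \<open>H i\<close> and \<open>d\<^sub>i\<close> the weighted outdegree of \<open>i\<close> in \<open>G\<close>, plus a matrix that is constant on blocks.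
  As \<open>L\<^sub>i\<close> annihilates the constant vector, its determinant is the product of all
  \<open>det (L\<^sub>i + d\<^sub>i) / d\<^sub>i\<close> times the determinant of the weighted Laplacian of \<open>G\<close>. The factors
  \<open>det (L\<^sub>i + d\<^sub>i) / d\<^sub>i\<close> are the products over the eigenvalues.

  By the matrix forest theorem, both Laplacian determinants count rooted forests once a weight \<open>\<kappa>\<close>
  for being a root is added on the diagonal. With \<open>\<kappa> = s\<close> on block \<open>i\<^sub>0\<close> and \<open>\<kappa> = s\<^sup>2\<close> elsewhere
  all \<open>d\<^sub>i + \<kappa>\<^sub>i\<close> are nonzero for \<open>s > 0\<close>; dividing by \<open>s\<close> and letting \<open>s\<close> tend to \<open>0\<close> only the trees
  rooted in block \<open>i\<^sub>0\<close> survive.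
\<close>

subsection \<open>Determinants indexed by a finite set\<close>

text \<open>The Leibniz formula over an arbitrary index set. The index sets below are vertex sets,
  dependent sums and disjoint unions, and block arguments are cleaner there than with numbered
  rows.\<close>

definition set_det :: "'a set \<Rightarrow> ('a \<Rightarrow> 'a \<Rightarrow> 'c) \<Rightarrow> 'c :: comm_ring_1" where
  "set_det V M = (\<Sum>p | p permutes V. of_int (sign p) * (\<Prod>v\<in>V. M v (p v)))"

lemma set_det_cong:
  assumes "\<And>u v. u \<in> V \<Longrightarrow> v \<in> V \<Longrightarrow> M u v = N u v"
  shows "set_det V M = set_det V N"
  unfolding set_det_def
  by (intro sum.cong refl arg_cong2[where f = "(*)"] prod.cong assms) (auto simp: permutes_in_image)

lemma set_det_reindex:
  assumes "inj_on f A" "finite A"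
  shows "set_det (f ` A) M = set_det A (\<lambda>a b. M (f a) (f b))"
  unfolding set_det_def
proof (rule sum.reindex_bij_betw[symmetric, THEN trans])
  have bij: "bij_betw f A (f ` A)"
    using assms(1) by (simp add: bij_betw_def)
  show "bij_betw (map_permutation A f) {p. p permutes A} {p. p permutes f ` A}"
  proof (rule bij_betwI[where g = "map_permutation (f ` A) (inv_into A f)"])
    show "map_permutation A f \<in> {p. p permutes A} \<rightarrow> {p. p permutes f ` A}"
      using map_permutation_permutes[OF bij] by auto
    show "map_permutation (f ` A) (inv_into A f) \<in> {p. p permutes f ` A} \<rightarrow> {p. p permutes A}"
      using map_permutation_permutes[OF bij_betw_inv_into[OF bij]] by auto
    show "map_permutation (f ` A) (inv_into A f) (map_permutation A f p) = p" if "p \<in> {p. p permutes A}" for p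
      using that assms by (intro map_permutation_compose_inv[OF bij]) auto
    show "map_permutation A f (map_permutation (f ` A) (inv_into A f) p) = p"
      if "p \<in> {p. p permutes f ` A}" for p
      using that assms by (intro map_permutation_compose_inv[OF bij_betw_inv_into[OF bij]])
        (auto simp: f_inv_into_f)
  qed
  show "(\<Sum>p | p permutes A. of_int (sign (map_permutation A f p)) *
        (\<Prod>v\<in>f ` A. M v (map_permutation A f p v))) =
      (\<Sum>p | p permutes A. of_int (sign p) * (\<Prod>v\<in>A. M (f v) (f (p v))))"
    using assms
    by (intro sum.cong refl arg_cong2[where f = "(*)"])
       (auto simp: sign_map_permutation prod.reindex map_permutation_apply)
qed

text \<open>The bridge to matrices with numbered rows. Every enumeration gives the same value, so
  the choice made in \<open>vertex_enum\<close> does not matter.\<close>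

lemma det_mat_nth:
  assumes "distinct vs"
  shows "det (mat (length vs) (length vs) (\<lambda>(a, b). M (vs ! a) (vs ! b))) = set_det (set vs) M"
proof -
  have "set_det (set vs) M = set_det ((!) vs ` {0..<length vs}) M"
    by (metis map_nth set_map set_upt)
  also have "\<dots> = set_det {0..<length vs} (\<lambda>a b. M (vs ! a) (vs ! b))"
    using assms by (intro set_det_reindex) (auto simp: inj_on_nth)
  also have "\<dots> = det (mat (length vs) (length vs) (\<lambda>(a, b). M (vs ! a) (vs ! b)))"
    unfolding set_det_def
    by (subst det_def'[of _ "length vs"])
       (auto intro!: sum.cong prod.cong arg_cong2[where f = "(*)"] simp: permutes_in_image)
  finally show ?thesis ..
qed

lemma sum_set_nth:
  assumes "distinct vs"
  shows "(\<Sum>v\<in>set vs. f v) = (\<Sum>i = 0..<length vs. f (vs ! i))"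
  by (rule sum.reindex_bij_betw[symmetric], rule bij_betw_nth) (use assms in auto)

lemma set_det_mult:
  assumes "finite V"
  shows "set_det V (\<lambda>u w. \<Sum>v\<in>V. M u v * N v w) = set_det V M * set_det V N"
proof -
  obtain vs where vs: "distinct vs" "set vs = V"
    using finite_distinct_list[OF assms] by blast
  define mt where "mt K = mat (length vs) (length vs) (\<lambda>(a, b). K (vs ! a) (vs ! b))"
    for K :: "'a \<Rightarrow> 'a \<Rightarrow> 'b"
  have det: "det (mt K) = set_det V K" for K
    unfolding mt_def using det_mat_nth[OF vs(1)] vs(2) by simp
  have "mt (\<lambda>u w. \<Sum>v\<in>V. M u v * N v w) = mt M * mt N"
    unfolding mt_def vs(2)[symmetric] sum_set_nth[OF vs(1)]
    by (intro eq_matI) (auto simp: scalar_prod_def)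
  then show ?thesis
    using det_mult[of "mt M" "length vs" "mt N"] unfolding det[symmetric] by (simp add: mt_def)
qed

section \<open>Determinants of block triangular, diagonal and singular matrices\<close>

lemma set_det_empty [simp]: "set_det {} M = 1"
  by (simp add: set_det_def)

lemma set_det_singleton [simp]: "set_det {a} M = M a a"
  by (simp add: set_det_def permutes_sing)

lemma set_det_block_lower:
  fixes M :: "'a \<Rightarrow> 'a \<Rightarrow> 'b :: idom"
  assumes "finite A" "finite B" "A \<inter> B = {}" "\<And>a b. a \<in> A \<Longrightarrow> b \<in> B \<Longrightarrow> M a b = 0"
  shows "set_det (A \<union> B) M = set_det A M * set_det B M"
proof -
  obtain as bs where as: "distinct as" "set as = A" and bs: "distinct bs" "set bs = B"
    using assms finite_distinct_list by metis
  define mt where "mt xs ys = mat (length xs) (length ys) (\<lambda>(a, b). M (xs ! a) (ys ! b))" for xs ys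
  \<comment> \<open>Enumerating \<open>A\<close> before \<open>B\<close> makes the zero block of
    \<open>M\<close> the upper right block.\<close>
  have "mt (as @ bs) (as @ bs) = four_block_mat (mt as as) (mt as bs) (mt bs as) (mt bs bs)"
    by (intro eq_matI) (auto simp: mt_def nth_append)
  moreover have "mt as bs = 0\<^sub>m (length as) (length bs)"
    using as bs assms(4) by (intro eq_matI) (auto simp: mt_def)
  ultimately have "det (mt (as @ bs) (as @ bs)) = det (mt as as) * det (mt bs bs)"
    by (simp only:) (rule det_four_block_mat_upper_right_zero, auto simp: mt_def)
  then show ?thesis
    unfolding mt_def using as bs assms(3)
    by (simp add: det_mat_nth del: length_append)
qed

lemma set_det_block_upper:
  fixes M :: "'a \<Rightarrow> 'a \<Rightarrow> 'b :: idom"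
  assumes "finite A" "finite B" "A \<inter> B = {}" "\<And>a b. a \<in> A \<Longrightarrow> b \<in> B \<Longrightarrow> M b a = 0"
  shows "set_det (A \<union> B) M = set_det A M * set_det B M"
  using set_det_block_lower[of B A M] assms by (simp add: Un_commute Int_commute mult.commute)

lemma set_det_diag:
  fixes d :: "'a \<Rightarrow> 'b :: idom"
  assumes "finite A"
  shows "set_det A (\<lambda>a b. if a = b then d a else 0) = (\<Prod>a\<in>A. d a)"
  using assms
proof (induction A rule: finite_induct)
  case (insert x A)
  have "set_det ({x} \<union> A) (\<lambda>a b. if a = b then d a else 0) =
      set_det {x} (\<lambda>a b. if a = b then d a else 0) * set_det A (\<lambda>a b. if a = b then d a else 0)"
    using insert.hyps by (intro set_det_block_lower) auto
  then show ?case
    using insert by simp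
qed simp

lemma set_det_Sigma:
  fixes M :: "'i \<times> 'a \<Rightarrow> 'i \<times> 'a \<Rightarrow> 'b :: idom"
  assumes "finite I" "\<And>i. i \<in> I \<Longrightarrow> finite (B i)"
    and "\<And>i j u v. i \<noteq> j \<Longrightarrow> M (i, u) (j, v) = 0"
  shows "set_det (Sigma I B) M = (\<Prod>i\<in>I. set_det (B i) (\<lambda>u v. M (i, u) (i, v)))"
  using assms(1,2)
proof (induction I rule: finite_induct)
  case (insert i I)
  have "Sigma (insert i I) B = Pair i ` B i \<union> Sigma I B"
    by auto
  moreover have "set_det (Pair i ` B i \<union> Sigma I B) M = set_det (Pair i ` B i) M * set_det (Sigma I B) M"
    using insert.hyps insert.prems by (intro set_det_block_lower) (auto intro!: assms(3))
  moreover have "set_det (Pair i ` B i) M = set_det (B i) (\<lambda>u v. M (i, u) (i, v))"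
    using insert.prems by (intro set_det_reindex) (auto simp: inj_on_def)
  ultimately show ?case
    using insert by simp
qed simp

text \<open>The criterion that removes parent functions with a cycle from the matrix forest theorem;
  the entry at \<open>v\<close> guarantees that the kernel vector is nonzero.\<close>

lemma set_det_eq_0:
  fixes M :: "'a \<Rightarrow> 'a \<Rightarrow> 'b :: idom"
  assumes "finite V" "v \<in> V" "x v \<noteq> 0" "\<And>u. u \<in> V \<Longrightarrow> (\<Sum>w\<in>V. M u w * x w) = 0"
  shows "set_det V M = 0"
proof -
  obtain vs where vs: "distinct vs" "set vs = V"
    using finite_distinct_list[OF assms(1)] by blast
  define A where "A = mat (length vs) (length vs) (\<lambda>(a, b). M (vs ! a) (vs ! b))"
  have A: "A \<in> carrier_mat (length vs) (length vs)"
    by (simp add: A_def)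
  define y where "y = vec (length vs) (\<lambda>a. x (vs ! a))"
  obtain i where "i < length vs" "vs ! i = v"
    using assms(2) vs(2) by (metis in_set_conv_nth)
  then have "y $ i \<noteq> 0" "y \<in> carrier_vec (length vs)"
    using assms(3) by (auto simp: y_def)
  moreover from this have "y \<noteq> 0\<^sub>v (length vs)"
    using \<open>i < length vs\<close> by auto
  moreover have "A *\<^sub>v y = 0\<^sub>v (length vs)"
  proof (intro eq_vecI)
    fix a assume a: "a < dim_vec (0\<^sub>v (length vs))"
    have "(A *\<^sub>v y) $ a = (\<Sum>b = 0..<length vs. M (vs ! a) (vs ! b) * x (vs ! b))"
      using a by (simp add: A_def y_def scalar_prod_def)
    also have "\<dots> = (\<Sum>w\<in>V. M (vs ! a) w * x w)"
      using sum_set_nth[OF vs(1), of "\<lambda>w. M (vs ! a) w * x w"] vs(2) by simp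
    also have "\<dots> = 0"
      using a vs by (intro assms(4)) auto
    finally show "(A *\<^sub>v y) $ a = 0\<^sub>v (length vs) $ a"
      using a by simp
  qed (simp add: A_def)
  ultimately have "det A = 0"
    using det_0_iff_vec_prod_zero[OF A] by blast
  then show ?thesis
    using det_mat_nth[OF vs(1), of M] vs(2) by (simp add: A_def)
qed

subsection \<open>The matrix forest theorem\<close>

text \<open>Multilinearity in the rows: distributing the product of row sums yields one term for
  each function \<open>f\<close> choosing a summand in every row.\<close>

lemma set_det_sum_rows:
  assumes "finite V" "\<And>v. v \<in> V \<Longrightarrow> finite (C v)"
  shows "set_det V (\<lambda>u v. \<Sum>c\<in>C u. W u c * B u c v) =
    (\<Sum>f\<in>Pi\<^sub>E V C. (\<Prod>v\<in>V. W v (f v)) * set_det V (\<lambda>u v. B u (f u) v))"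
proof -
  have "set_det V (\<lambda>u v. \<Sum>c\<in>C u. W u c * B u c v) =
      (\<Sum>p | p permutes V. \<Sum>f\<in>Pi\<^sub>E V C. of_int (sign p) * (\<Prod>v\<in>V. W v (f v) * B v (f v) (p v)))"
    unfolding set_det_def using assms by (simp add: prod_sum_PiE sum_distrib_left)
  also have "\<dots> = (\<Sum>f\<in>Pi\<^sub>E V C. (\<Prod>v\<in>V. W v (f v)) * set_det V (\<lambda>u v. B u (f u) v))"
    unfolding set_det_def
    by (subst sum.swap) (simp add: prod.distrib sum_distrib_left mult.left_commute)
  finally show ?thesis .
qed

text \<open>
  A rooted forest is encoded by its parent function: \<open>f v = None\<close> says that \<open>v\<close> is a root, and
  \<open>f v = Some u\<close> that \<open>(v, u)\<close> is an arc. Outside \<open>V\<close> the function is \<open>undefined\<close>, which may itself be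
  of the form \<open>Some u\<close>; hence the explicit \<open>v \<in> V\<close> below.
\<close>

definition forest_arcs :: "'a set \<Rightarrow> ('a \<Rightarrow> 'a option) \<Rightarrow> ('a \<times> 'a) set" where
  "forest_arcs V f = {(v, u). v \<in> V \<and> f v = Some u}"

definition rooted_forests :: "'a set \<Rightarrow> ('a \<Rightarrow> 'a option) set" where
  "rooted_forests V = {f \<in> V \<rightarrow>\<^sub>E insert None (Some ` V). acyclic (forest_arcs V f)}"

lemma finite_forest_arcs:
  assumes "finite V" "f \<in> V \<rightarrow>\<^sub>E insert None (Some ` V)"
  shows "finite (forest_arcs V f)"
  by (rule finite_subset[of _ "V \<times> V"]) (use assms in \<open>auto simp: forest_arcs_def PiE_def Pi_def\<close>)

lemma finite_rooted_forests: "finite V \<Longrightarrow> finite (rooted_forests V)"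
  unfolding rooted_forests_def by (rule finite_subset[OF _ finite_PiE[of V "\<lambda>_. insert None (Some ` V)"]]) auto

text \<open>Identity minus the adjacency matrix of the parent function. The row of a root is a unit
  vector rather than zero, because the root weight has been factored out of it.\<close>

definition functional_laplacian :: "('a \<Rightarrow> 'a option) \<Rightarrow> 'a \<Rightarrow> 'a \<Rightarrow> 'b :: comm_ring_1" where
  "functional_laplacian f u v = of_bool (u = v) - of_bool (f u = Some v)"

lemma set_det_functional_laplacian_acyclic:
  assumes "finite V" "f \<in> rooted_forests V"
  shows "set_det V (functional_laplacian f) = (1 :: 'b :: idom)"
proof -
  have f: "f \<in> V \<rightarrow>\<^sub>E insert None (Some ` V)" "acyclic (forest_arcs V f)"
    using assms(2) by (auto simp: rooted_forests_def)
  \<comment> \<open>Induction along the converse relation treats the parent of a vertex before the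
    vertex itself, starting from the roots.\<close>
  have wf: "wf ((forest_arcs V f)\<inverse>)"
    using finite_forest_arcs[OF assms(1) f(1)] f(2) by (rule finite_acyclic_wf_converse)
  have irrefl: "f v \<noteq> Some v" if "v \<in> V" for v
    using f(2) that unfolding acyclic_def forest_arcs_def by auto
  \<comment> \<open>Only the identity contributes to the Leibniz sum: if the parent of \<open>v\<close> is fixed by \<open>p\<close>, then
    \<open>v\<close> cannot be mapped to it.\<close>
  have fixed: "p = id" if p: "p permutes V" and ne: "\<And>v. v \<in> V \<Longrightarrow> p v = v \<or> f v = Some (p v)" for p
  proof
    fix v
    show "p v = id v"
      using wf
    proof (induction v rule: wf_induct_rule)
      case (less v)
      show ?case
      proof (cases "v \<in> V \<and> f v = Some (p v)")
        case True
        then have "p (p v) = p v"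
          using less[of "p v"] by (auto simp: forest_arcs_def)
        then show ?thesis
          using permutes_inj[OF p] by (auto dest: injD)
      next
        case False
        then show ?thesis
          using ne[of v] p by (cases "v \<in> V") (auto simp: permutes_not_in)
      qed
    qed
  qed
  have "set_det V (functional_laplacian f) =
      (\<Sum>p | p permutes V. if p = id then 1 else (0 :: 'b))"
    unfolding set_det_def
  proof (intro sum.cong refl)
    fix p assume "p \<in> {p. p permutes V}"
    then have p: "p permutes V" by simp
    show "of_int (sign p) * (\<Prod>v\<in>V. functional_laplacian f v (p v)) = (if p = id then 1 else (0 :: 'b))"
    proof (cases "p = id")
      case True
      then show ?thesis
        using irrefl by (simp add: functional_laplacian_def)
    next
      case False
      then obtain v where "v \<in> V" "p v \<noteq> v" "f v \<noteq> Some (p v)"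
        using fixed[OF p] by blast
      then have "functional_laplacian f v (p v) = (0 :: 'b)"
        by (simp add: functional_laplacian_def)
      then have "(\<Prod>v\<in>V. functional_laplacian f v (p v)) = (0 :: 'b)"
        using \<open>v \<in> V\<close> assms(1) by (intro prod_zero) blast+
      then show ?thesis
        using False by simp
    qed
  qed
  also have "\<dots> = 1"
    using finite_permutations[OF assms(1)] permutes_id by (subst sum.delta) auto
  finally show ?thesis .
qed

lemma set_det_functional_laplacian_cyclic:
  assumes "finite V" "f \<in> V \<rightarrow>\<^sub>E insert None (Some ` V)" "f \<notin> rooted_forests V"
  shows "set_det V (functional_laplacian f) = (0 :: 'b :: idom)"
proof -
  define R where "R = forest_arcs V f"
  obtain x where x: "(x, x) \<in> R\<^sup>+"
    using assms(2,3) unfolding rooted_forests_def acyclic_def R_def by auto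
  have fV: "u \<in> V" if "v \<in> V" "f v = Some u" for u v
    using assms(2) that by (auto simp: PiE_def Pi_def)
  \<comment> \<open>The indicator of the vertices leading into the cycle through \<open>x\<close> is a kernel vector.\<close>
  have next_R: "(v, x) \<in> R\<^sup>* \<longleftrightarrow> (\<exists>u. f v = Some u \<and> (u, x) \<in> R\<^sup>*)" if "v \<in> V" for v
  proof
    assume "(v, x) \<in> R\<^sup>*"
    \<comment> \<open>As \<open>x\<close> lies on a cycle, even the trivial path from
      \<open>x\<close> to itself can be replaced by one that starts with an arc.\<close>
    then have "(v, x) \<in> R\<^sup>+"
      using x by (auto simp: rtrancl_eq_or_trancl)
    then show "\<exists>u. f v = Some u \<and> (u, x) \<in> R\<^sup>*"
      by (auto dest!: tranclD simp: R_def forest_arcs_def)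
  next
    assume "\<exists>u. f v = Some u \<and> (u, x) \<in> R\<^sup>*"
    then show "(v, x) \<in> R\<^sup>*"
      using that by (auto simp: R_def forest_arcs_def intro: converse_rtrancl_into_rtrancl)
  qed
  have "x \<in> V"
    using tranclD[OF x] by (auto simp: R_def forest_arcs_def)
  show ?thesis
  proof (rule set_det_eq_0[where v = x and x = "\<lambda>v. of_bool ((v, x) \<in> R\<^sup>*)"])
    fix u assume u: "u \<in> V"
    let ?g = "\<lambda>v. of_bool ((v, x) \<in> R\<^sup>*) :: 'b"
    have "(\<Sum>w\<in>V. functional_laplacian f u w * ?g w) =
        (\<Sum>w\<in>V. if u = w then ?g w else 0) - (\<Sum>w\<in>V. if f u = Some w then ?g w else 0)"
      unfolding sum_subtractf[symmetric]
      by (intro sum.cong refl) (simp add: functional_laplacian_def algebra_simps)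
    \<comment> \<open>The sum is the value of \<open>?g\<close> at the parent of \<open>u\<close>,
      or 0 if \<open>u\<close> is a root; by \<open>next_R\<close> both equal
      \<open>?g u\<close>.\<close>
    also have "(\<Sum>w\<in>V. if f u = Some w then ?g w else 0) = ?g u"
    proof (cases "f u")
      case None
      then show ?thesis
        using next_R[OF u] by simp
    next
      case (Some y)
      then show ?thesis
        using next_R[OF u] fV[OF u] assms(1) by simp
    qed
    finally show "(\<Sum>w\<in>V. functional_laplacian f u w * ?g w) = 0"
      using u assms(1) by simp
  qed (use assms(1) \<open>x \<in> V\<close> in auto)
qed

definition forest_weight :: "('a \<Rightarrow> 'b) \<Rightarrow> ('a \<Rightarrow> 'a \<Rightarrow> 'b) \<Rightarrow> ('a \<Rightarrow> 'a option) \<Rightarrow> 'a \<Rightarrow> 'b" where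
  "forest_weight \<kappa> w f v = (case f v of None \<Rightarrow> \<kappa> v | Some u \<Rightarrow> w v u)"

text \<open>Row \<open>u\<close> is a sum of choices: being a root contributes \<kappa> u times the
  unit vector at \<open>u\<close>, and the parent \<open>x\<close> contributes \<open>w u x\<close>
  times the difference of the unit vectors at \<open>u\<close> and \<open>x\<close>. Expanding all
  rows gives a sum over all parent functions, in which the determinant is 1 for the acyclic ones and
  0 for the others.\<close>

theorem matrix_forest:
  fixes w :: "'a \<Rightarrow> 'a \<Rightarrow> 'b :: idom"
  assumes "finite V"
  shows "set_det V (\<lambda>u v. (if u = v then \<kappa> u + (\<Sum>x\<in>V. w u x) else 0) - w u v) =
    (\<Sum>f\<in>rooted_forests V. \<Prod>v\<in>V. forest_weight \<kappa> w f v)"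
proof -
  define C where "C = insert None (Some ` V)"
  define W where "W v c = (case c of None \<Rightarrow> \<kappa> v | Some u \<Rightarrow> w v u)" for v c
  define B where "B u c v = (of_bool (u = v) - of_bool (c = Some v) :: 'b)" for u v :: 'a and c
  have "(\<Sum>c\<in>C. W u c * B u c v) = (if u = v then \<kappa> u + (\<Sum>x\<in>V. w u x) else 0) - w u v"
    if "u \<in> V" "v \<in> V" for u v
  proof -
    have "(\<Sum>c\<in>C. W u c * B u c v) =
        \<kappa> u * of_bool (u = v) + (\<Sum>x\<in>V. w u x * (of_bool (u = v) - of_bool (x = v)))"
      using assms by (simp add: C_def W_def B_def sum.reindex)
    also have "(\<Sum>x\<in>V. w u x * (of_bool (u = v) - of_bool (x = v))) =
        (\<Sum>x\<in>V. w u x) * of_bool (u = v) - (\<Sum>x\<in>V. if x = v then w u x else 0)"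
      unfolding sum_distrib_right sum_subtractf[symmetric]
      by (intro sum.cong refl) (simp add: algebra_simps)
    finally show ?thesis
      using assms that by simp
  qed
  then have "set_det V (\<lambda>u v. (if u = v then \<kappa> u + (\<Sum>x\<in>V. w u x) else 0) - w u v) =
      set_det V (\<lambda>u v. \<Sum>c\<in>C. W u c * B u c v)"
    by (intro set_det_cong) auto
  also have "\<dots> = (\<Sum>f\<in>V \<rightarrow>\<^sub>E C. (\<Prod>v\<in>V. W v (f v)) * set_det V (functional_laplacian f))"
    using assms by (subst set_det_sum_rows) (auto simp: C_def B_def[abs_def] functional_laplacian_def[abs_def])
  also have "\<dots> = (\<Sum>f\<in>rooted_forests V. (\<Prod>v\<in>V. W v (f v)) * set_det V (functional_laplacian f))"
    using assms set_det_functional_laplacian_cyclic[OF assms]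
    by (intro sum.mono_neutral_right) (auto simp: rooted_forests_def C_def intro!: finite_PiE)
  also have "\<dots> = (\<Sum>f\<in>rooted_forests V. \<Prod>v\<in>V. forest_weight \<kappa> w f v)"
    using set_det_functional_laplacian_acyclic[OF assms, where 'b = 'b]
    by (intro sum.cong refl) (simp add: W_def forest_weight_def)
  finally show ?thesis .
qed

subsection \<open>Forests with one root and oriented spanning trees\<close>

definition forest_roots :: "'a set \<Rightarrow> ('a \<Rightarrow> 'a option) \<Rightarrow> 'a set" where
  "forest_roots V f = {v \<in> V. f v = None}"

lemma forest_roots_singletonD:
  assumes "forest_roots V f = {r}" "v \<in> V"
  shows "f v = None \<longleftrightarrow> v = r"
proof -
  have "v \<in> forest_roots V f \<longleftrightarrow> v = r"
    by (simp add: assms(1))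
  then show ?thesis
    using assms(2) by (simp add: forest_roots_def)
qed

lemma rooted_forest_wf:
  assumes "finite V" "f \<in> rooted_forests V"
  shows "wf ((forest_arcs V f)\<inverse>)"
  using assms finite_forest_arcs[of V f] by (auto simp: rooted_forests_def intro: finite_acyclic_wf_converse)

lemma rooted_forest_closed:
  assumes "f \<in> rooted_forests V" "v \<in> V" "f v = Some u"
  shows "u \<in> V"
  using assms by (auto simp: rooted_forests_def PiE_def Pi_def)

text \<open>Passing from parent to parent has to stop, and it stops at a root.\<close>

lemma forest_roots_nonempty:
  assumes "finite V" "V \<noteq> {}" "f \<in> rooted_forests V"
  shows "forest_roots V f \<noteq> {}"
proof -
  obtain v where "v \<in> V"
    using assms(2) by blast
  from wfE_min[OF rooted_forest_wf[OF assms(1,3)] this]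
  obtain z where "z \<in> V" "\<And>y. (y, z) \<in> (forest_arcs V f)\<inverse> \<Longrightarrow> y \<notin> V"
    by blast
  then have "f z = None"
    using rooted_forest_closed[OF assms(3) \<open>z \<in> V\<close>] unfolding forest_arcs_def by (cases "f z") blast+
  then show ?thesis
    using \<open>z \<in> V\<close> by (auto simp: forest_roots_def)
qed

text \<open>The weight of a forest contains one factor \<kappa> for each root. Division by
  \<open>s\<close> is absorbed by one of these factors, and any further one tends to 0, so only the
  forests with a single root contribute to the limit.\<close>

lemma tendsto_forest_sum:
  fixes \<kappa> :: "'x \<Rightarrow> 'a \<Rightarrow> 'b :: real_normed_field"
  assumes V: "finite V" "V \<noteq> {}"
    and lim0: "\<And>v. v \<in> V \<Longrightarrow> ((\<lambda>x. \<kappa> x v) \<longlongrightarrow> 0) F"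
    and lim1: "\<And>v. v \<in> V \<Longrightarrow> ((\<lambda>x. \<kappa> x v / s x) \<longlongrightarrow> c v) F"
  shows "((\<lambda>x. (\<Sum>f\<in>rooted_forests V. \<Prod>v\<in>V. forest_weight (\<kappa> x) w f v) / s x) \<longlongrightarrow>
    (\<Sum>u\<in>V. c u * (\<Sum>f\<in>{f \<in> rooted_forests V. forest_roots V f = {u}}. \<Prod>v\<in>V - {u}. w v (the (f v))))) F"
proof -
  define P where "P f = (\<Prod>v\<in>V - forest_roots V f. w v (the (f v)))" for f
  have split: "(\<Prod>v\<in>V. forest_weight (\<kappa> x) w f v) = (\<Prod>v\<in>forest_roots V f. \<kappa> x v) * P f" for x f
  proof -
    have "(\<Prod>v\<in>V. forest_weight (\<kappa> x) w f v) =
        (\<Prod>v\<in>V - forest_roots V f. forest_weight (\<kappa> x) w f v) * (\<Prod>v\<in>forest_roots V f. forest_weight (\<kappa> x) w f v)"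
      using V(1) by (intro prod.subset_diff) (auto simp: forest_roots_def)
    also have "(\<Prod>v\<in>V - forest_roots V f. forest_weight (\<kappa> x) w f v) = P f"
      unfolding P_def by (intro prod.cong) (auto simp: forest_roots_def forest_weight_def)
    also have "(\<Prod>v\<in>forest_roots V f. forest_weight (\<kappa> x) w f v) = (\<Prod>v\<in>forest_roots V f. \<kappa> x v)"
      by (intro prod.cong) (auto simp: forest_roots_def forest_weight_def)
    finally show ?thesis
      by (simp add: mult.commute)
  qed
  \<comment> \<open>The limit is written as a sum over \<open>u\<close> with at most one nonzero
    term, so that exchanging the sums later groups the forests by their root.\<close>
  have lim: "((\<lambda>x. (\<Prod>v\<in>V. forest_weight (\<kappa> x) w f v) / s x) \<longlongrightarrow>
      (\<Sum>u\<in>V. if forest_roots V f = {u} then c u * P f else 0)) F" if f: "f \<in> rooted_forests V" for f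
  proof -
    obtain r where r: "r \<in> forest_roots V f"
      using forest_roots_nonempty[OF V f] by blast
    let ?R = "forest_roots V f - {r}"
    have finR: "finite (forest_roots V f)" and rV: "r \<in> V" and sub: "?R \<subseteq> V"
      using V(1) r by (auto simp: forest_roots_def)
    \<comment> \<open>The product of zeros over \<open>?R\<close> encodes the case distinction: it
      is the empty product 1 if \<open>r\<close> is the only root, and 0 otherwise.\<close>
    have "((\<lambda>x. \<kappa> x r / s x * ((\<Prod>v\<in>?R. \<kappa> x v) * P f)) \<longlongrightarrow> c r * ((\<Prod>v\<in>?R. 0) * P f)) F"
      using sub by (intro tendsto_intros lim1 rV lim0) auto
    moreover have "\<kappa> x r / s x * ((\<Prod>v\<in>?R. \<kappa> x v) * P f) = (\<Prod>v\<in>V. forest_weight (\<kappa> x) w f v) / s x" for x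
      unfolding split prod.remove[OF finR r] by simp
    moreover have "c r * ((\<Prod>v\<in>?R. 0) * P f) = (\<Sum>u\<in>V. if forest_roots V f = {u} then c u * P f else 0)"
    proof (cases "?R = {}")
      case True
      then have "forest_roots V f = {r}"
        using r by auto
      then show ?thesis
        using rV V(1) True by (auto simp: sum.delta)
    next
      case False
      then have "forest_roots V f \<noteq> {u}" for u
        using r by auto
      moreover have "(\<Prod>v\<in>?R. 0) = (0 :: 'b)"
        using False finR prod_zero[of ?R "\<lambda>_. 0"] by blast
      ultimately show ?thesis
        by simp
    qed
    ultimately show ?thesis
      by (simp only:)
  qed
  have "(\<Sum>f\<in>rooted_forests V. \<Sum>u\<in>V. if forest_roots V f = {u} then c u * P f else 0) =
      (\<Sum>u\<in>V. \<Sum>f\<in>rooted_forests V. if forest_roots V f = {u} then c u * P f else 0)"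
    by (rule sum.swap)
  also have "\<dots> = (\<Sum>u\<in>V. c u * (\<Sum>f\<in>{f \<in> rooted_forests V. forest_roots V f = {u}}. \<Prod>v\<in>V - {u}. w v (the (f v))))"
  proof (intro sum.cong refl)
    fix u
    have "(\<Sum>f\<in>rooted_forests V. if forest_roots V f = {u} then c u * P f else 0) =
        (\<Sum>f\<in>{f \<in> rooted_forests V. forest_roots V f = {u}}. c u * P f)"
      using V(1) by (simp add: sum.inter_filter finite_rooted_forests)
    also have "\<dots> = c u * (\<Sum>f\<in>{f \<in> rooted_forests V. forest_roots V f = {u}}. \<Prod>v\<in>V - {u}. w v (the (f v)))"
      unfolding sum_distrib_left by (intro sum.cong refl) (auto simp: P_def)
    finally show "(\<Sum>f\<in>rooted_forests V. if forest_roots V f = {u} then c u * P f else 0) = \<dots>" .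
  qed
  finally show ?thesis
    using tendsto_sum[where I = "rooted_forests V" and f = "\<lambda>f x. (\<Prod>v\<in>V. forest_weight (\<kappa> x) w f v) / s x", OF lim] by (simp add: sum_divide_distrib)
qed

section \<open>Oriented spanning trees as parent functions\<close>

text \<open>\<open>forest\<close> excludes cycles without repeated vertices, \<open>acyclic\<close>
  excludes all nonempty closed walks. The two agree because a nonempty closed walk contains a
  cycle.\<close>

lemma pair_forest_iff_acyclic:
  assumes "wf_digraph (with_proj T)"
  shows "forest (with_proj T) \<longleftrightarrow> acyclic (parcs T)"
proof -
  interpret wf_digraph "with_proj T" by fact
  show ?thesis
  proof
    assume *: "forest (with_proj T)"
    show "acyclic (parcs T)"
      unfolding acyclic_def
    proof (intro allI notI)
      fix x assume "(x, x) \<in> (parcs T)\<^sup>+"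
      then have "x \<rightarrow>\<^sup>+\<^bsub>with_proj T\<^esub> x"
        by simp
      then obtain p where "awalk x p x" "p \<noteq> []"
        unfolding reachable1_awalk by blast
      then have "closed_w p"
        by (auto simp: closed_w_def)
      then show False
        using closed_w_imp_cycle * by (auto simp: forest_def)
    qed
  next
    assume *: "acyclic (parcs T)"
    have False if "cycle p" for p
    proof -
      obtain u where "awalk u p u" "p \<noteq> []"
        using \<open>cycle p\<close> by (auto simp: cycle_def)
      then have "u \<rightarrow>\<^sup>+\<^bsub>with_proj T\<^esub> u"
        unfolding reachable1_awalk by blast
      then show False
        using * by (simp add: acyclic_def)
    qed
    then show "forest (with_proj T)"
      by (auto simp: forest_def)
  qed
qed

definition forest_digraph :: "'a set \<Rightarrow> ('a \<Rightarrow> 'a option) \<Rightarrow> 'a pair_pre_digraph" where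
  "forest_digraph V f = \<lparr> pverts = V, parcs = forest_arcs V f \<rparr>"

lemma forest_digraph_simps [simp]:
  "pverts (forest_digraph V f) = V" "parcs (forest_digraph V f) = forest_arcs V f"
  by (simp_all add: forest_digraph_def)

lemma wf_forest_digraph:
  assumes "f \<in> rooted_forests V"
  shows "wf_digraph (with_proj (forest_digraph V f))"
  using rooted_forest_closed[OF assms] by unfold_locales (auto simp: forest_arcs_def)

text \<open>Every vertex reaches the only root along its parents, and in the symmetric closure the
  same path leads back.\<close>

lemma connected_forest_digraph:
  assumes "finite V" "f \<in> rooted_forests V" "forest_roots V f = {r}"
  shows "Digraph_Component.connected (with_proj (forest_digraph V f))"
proof -
  define E where "E = forest_arcs V f \<union> (forest_arcs V f)\<inverse>"
  have E: "parcs (mk_symmetric (with_proj (forest_digraph V f))) = E"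
    "pverts (mk_symmetric (with_proj (forest_digraph V f))) = V"
    by (auto simp: mk_symmetric_def E_def)
  have rV: "r \<in> V"
    using assms(3) by (auto simp: forest_roots_def)
  have reach: "v \<in> V \<longrightarrow> (v, r) \<in> rtrancl_on V E \<and> (r, v) \<in> rtrancl_on V E" for v
    using rooted_forest_wf[OF assms(1,2)]
  proof (induction v rule: wf_induct_rule)
    case (less v)
    show ?case
    proof
      assume v: "v \<in> V"
      show "(v, r) \<in> rtrancl_on V E \<and> (r, v) \<in> rtrancl_on V E"
      proof (cases "f v")
        case None
        then have "v = r"
          using v assms(3) by (auto simp: forest_roots_def)
        then show ?thesis
          using rV by simp
      next
        case (Some u)
        then have "(v, u) \<in> forest_arcs V f" "u \<in> V"
          using v rooted_forest_closed[OF assms(2)] by (auto simp: forest_arcs_def)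
        then have "(u, r) \<in> rtrancl_on V E" "(r, u) \<in> rtrancl_on V E" "(v, u) \<in> E" "(u, v) \<in> E"
          using less by (auto simp: E_def)
        then show ?thesis
          using v by (blast intro: converse_rtrancl_on_into_rtrancl_on rtrancl_on_into_rtrancl_on)
      qed
    qed
  qed
  show ?thesis
    unfolding Digraph_Component.connected_def strongly_connected_def reachable_def
    using rV reach by (auto simp: E intro: rtrancl_on_trans)
qed

lemma out_arcs_forest_digraph:
  assumes "v \<in> V"
  shows "out_arcs (with_proj (forest_digraph V f)) v = (case f v of None \<Rightarrow> {} | Some u \<Rightarrow> {(v, u)})"
  using assms by (auto simp: out_arcs_def forest_arcs_def split: option.splits)

lemma forest_digraph_oriented_spanning_tree:
  assumes "pair_digraph G" "f \<in> rooted_forests (pverts G)" "forest_roots (pverts G) f = {r}"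
    and "forest_arcs (pverts G) f \<subseteq> parcs G"
  shows "forest_digraph (pverts G) f \<in> oriented_spanning_trees G r"
proof -
  interpret pair_digraph G by fact
  let ?T = "forest_digraph (pverts G) f"
  have "wf_digraph (with_proj ?T)" "wf_digraph (with_proj G)"
    using wf_forest_digraph[OF assms(2)] wf_digraph_axioms by auto
  then have "spanning (with_proj ?T) (with_proj G)"
    using assms(4) by (auto simp: spanning_def subgraph_def compatible_def)
  moreover have "forest (with_proj ?T)"
    using assms(2) pair_forest_iff_acyclic[OF wf_forest_digraph[OF assms(2)]]
    by (simp add: rooted_forests_def)
  ultimately have "spanning_tree (with_proj ?T) (with_proj G)"
    using connected_forest_digraph[OF _ assms(2,3)] pair_finite_verts
    by (simp add: spanning_tree_def tree_def)
  moreover have r: "r \<in> pverts G"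
    using assms(3) by (auto simp: forest_roots_def)
  moreover have "out_degree (with_proj ?T) r = 0"
    using r forest_roots_singletonD[OF assms(3) r] by (simp add: out_degree_def out_arcs_forest_digraph)
  moreover have "out_degree (with_proj ?T) v = 1" if "v \<in> pverts G - {r}" for v
    using that forest_roots_singletonD[OF assms(3), of v]
    by (auto simp: out_degree_def out_arcs_forest_digraph)
  ultimately show ?thesis
    by (simp add: oriented_spanning_trees_def)
qed

lemma parcs_oriented_spanning_tree:
  assumes "T \<in> oriented_spanning_trees G r" "(u, v) \<in> parcs T"
  shows "(u, v) \<in> parcs G"
  using assms by (auto simp: oriented_spanning_trees_def spanning_tree_def spanning_def subgraph_def)

text \<open>The outdegree conditions say that every vertex except \<open>r\<close> has exactly one
  outgoing arc and \<open>r\<close> has none; mapping a vertex to the head of that arc recovers the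
  parent function.\<close>

lemma oriented_spanning_tree_forest_digraph:
  assumes "pair_digraph G" "T \<in> oriented_spanning_trees G r"
  obtains f where "f \<in> rooted_forests (pverts G)" "forest_roots (pverts G) f = {r}"
    "forest_arcs (pverts G) f \<subseteq> parcs G" "T = forest_digraph (pverts G) f"
proof -
  interpret pair_digraph G by fact
  define V where "V = pverts G"
  have T: "tree (with_proj T)" "wf_digraph (with_proj T)" "pverts T = V" "parcs T \<subseteq> parcs G"
    "r \<in> V" "card {e \<in> parcs T. fst e = r} = 0"
    and deg: "\<And>v. v \<in> V - {r} \<Longrightarrow> card {e \<in> parcs T. fst e = v} = 1"
    using assms(2) unfolding oriented_spanning_trees_def V_def
    by (auto simp: spanning_tree_def spanning_def subgraph_def out_degree_def out_arcs_def)
  \<comment> \<open>An infinite set also has \<open>card\<close> 0, so finiteness is needed to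
    conclude from outdegree 0 that \<open>r\<close> has no outgoing arc.\<close>
  have fin: "finite (parcs T)"
    using T(4) pair_finite_arcs by (rule finite_subset)
  have ends: "u \<in> V" "v \<in> V" if "(u, v) \<in> parcs T" for u v
    using wf_digraph.tail_in_verts[OF T(2)] wf_digraph.head_in_verts[OF T(2)] that T(3) by fastforce+
  have no_r: "(r, u) \<notin> parcs T" for u
    using T(6) fin by auto
  have ex1: "\<exists>!u. (v, u) \<in> parcs T" if v: "v \<in> V" "v \<noteq> r" for v
  proof -
    obtain e where e: "{e \<in> parcs T. fst e = v} = {e}"
      using deg[of v] v by (auto simp: card_1_singleton_iff)
    then have "(v, snd e) \<in> parcs T"
      by (metis (mono_tags, lifting) insertI1 mem_Collect_eq prod.collapse)
    moreover have "u = snd e" if "(v, u) \<in> parcs T" for u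
      using that e by (metis (mono_tags, lifting) fst_conv mem_Collect_eq singletonD snd_conv)
    ultimately show ?thesis
      by blast
  qed
  \<comment> \<open>The restriction to \<open>V\<close> makes \<open>f\<close> equal to
    \<open>undefined\<close> elsewhere, as the extensional function space requires.\<close>
  define f where "f = (\<lambda>v\<in>V. if v = r then None else Some (THE u. (v, u) \<in> parcs T))"
  have f_Some: "f v = Some u \<longleftrightarrow> (v, u) \<in> parcs T" if "v \<in> V" for u v
    using that no_r theI'[OF ex1[of v]] ex1[of v] by (auto simp: f_def)
  have arcs: "forest_arcs V f = parcs T"
    using f_Some ends by (auto simp: forest_arcs_def)
  have "f v \<in> insert None (Some ` V)" if "v \<in> V" for v
  proof (cases "f v")
    case (Some u)
    then have "u \<in> V"
      using f_Some[OF that, of u] ends(2) by blast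
    then show ?thesis
      using Some by simp
  qed simp
  then have "f \<in> V \<rightarrow>\<^sub>E insert None (Some ` V)"
    by (auto simp: f_def)
  moreover have "acyclic (parcs T)"
    using T(1) pair_forest_iff_acyclic[OF T(2)] by (simp add: tree_def)
  ultimately have "f \<in> rooted_forests V"
    by (simp add: rooted_forests_def arcs)
  moreover have "forest_roots V f = {r}"
    using T(5) by (auto simp: forest_roots_def f_def)
  moreover have "T = forest_digraph V f"
    using T(3) arcs by (cases T) (simp add: forest_digraph_def)
  ultimately show thesis
    using that[of f] T(4) arcs by (simp add: V_def)
qed

text \<open>The arcs determine \<open>f\<close> on \<open>V\<close>, the absence of an arc meaning
  \<open>None\<close>; outside \<open>V\<close> all members of \<open>rooted_forests V\<close>
  agree.\<close>

lemma inj_on_forest_digraph: "inj_on (forest_digraph V) (rooted_forests V)"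
proof (rule inj_onI)
  fix f g assume f: "f \<in> rooted_forests V" and g: "g \<in> rooted_forests V"
    and eq: "forest_digraph V f = forest_digraph V g"
  have "forest_arcs V f = forest_arcs V g"
    using eq by (simp add: forest_digraph_def)
  then have "f v = Some u \<longleftrightarrow> g v = Some u" if "v \<in> V" for u v
    using that by (auto simp: forest_arcs_def set_eq_iff)
  then have "f v = g v" if "v \<in> V" for v
    using that by (metis option.exhaust)
  then show "f = g"
    using f g by (intro PiE_ext[of f V _ g]) (auto simp: rooted_forests_def)
qed

lemma oriented_spanning_trees_eq:
  assumes "pair_digraph G"
  shows "oriented_spanning_trees G r = forest_digraph (pverts G) `
    {f \<in> rooted_forests (pverts G). forest_roots (pverts G) f = {r} \<and> forest_arcs (pverts G) f \<subseteq> parcs G}"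
  using forest_digraph_oriented_spanning_tree[OF assms] oriented_spanning_tree_forest_digraph[OF assms]
  by blast

text \<open>A parent function using a pair that is not an arc of \<open>G\<close> has weight 0, so
  the sum may run over all forests with root \<open>r\<close>, which is the form that the matrix
  forest theorem produces.\<close>

lemma sum_oriented_spanning_trees:
  fixes w :: "'a \<Rightarrow> 'a \<Rightarrow> 'b :: idom"
  assumes "pair_digraph G" "\<And>u v. u \<in> pverts G \<Longrightarrow> (u, v) \<notin> parcs G \<Longrightarrow> w u v = 0"
  shows "(\<Sum>T\<in>oriented_spanning_trees G r. \<Prod>(u, v)\<in>parcs T. w u v) =
    (\<Sum>f\<in>{f \<in> rooted_forests (pverts G). forest_roots (pverts G) f = {r}}.
      \<Prod>v\<in>pverts G - {r}. w v (the (f v)))"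
proof -
  interpret pair_digraph G by fact
  define V where "V = pverts G"
  define S where "S = {f \<in> rooted_forests V. forest_roots V f = {r}}"
  define S' where "S' = {f \<in> S. forest_arcs V f \<subseteq> parcs G}"
  have fin: "finite V" "finite S"
    using pair_finite_verts finite_rooted_forests[of V] by (auto simp: V_def S_def)
  \<comment> \<open>Each vertex other than \<open>r\<close> is the tail of exactly one arc, so
    products over arcs become products over these vertices.\<close>
  have arcs: "forest_arcs V f = (\<lambda>v. (v, the (f v))) ` (V - {r})" if "f \<in> S" for f
  proof -
    have "V - {r} = {v \<in> V. f v \<noteq> None}"
    proof (rule Set.set_eqI)
      show "v \<in> V - {r} \<longleftrightarrow> v \<in> {v \<in> V. f v \<noteq> None}" for v
        using forest_roots_singletonD[of V f r v] that by (cases "v \<in> V") (simp_all add: S_def del: not_None_eq)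
    qed
    then show ?thesis
      unfolding forest_arcs_def by force
  qed
  have prod: "(\<Prod>(u, v)\<in>forest_arcs V f. w u v) = (\<Prod>v\<in>V - {r}. w v (the (f v)))" if "f \<in> S" for f
    unfolding arcs[OF that] by (subst prod.reindex) (auto simp: inj_on_def)
  have "(\<Sum>T\<in>oriented_spanning_trees G r. \<Prod>(u, v)\<in>parcs T. w u v) =
      (\<Sum>T\<in>forest_digraph V ` S'. \<Prod>(u, v)\<in>parcs T. w u v)"
    unfolding oriented_spanning_trees_eq[OF assms(1)] V_def S_def S'_def by (simp add: conj_assoc)
  also have "\<dots> = (\<Sum>f\<in>S'. \<Prod>(u, v)\<in>forest_arcs V f. w u v)"
    by (subst sum.reindex)
       (auto simp: S'_def S_def intro: inj_on_subset[OF inj_on_forest_digraph])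
  also have "\<dots> = (\<Sum>f\<in>S. \<Prod>(u, v)\<in>forest_arcs V f. w u v)"
  proof (rule sum.mono_neutral_left)
    show "\<forall>f\<in>S - S'. (\<Prod>(u, v)\<in>forest_arcs V f. w u v) = 0"
    proof
      fix f assume "f \<in> S - S'"
      then obtain u v where uv: "(u, v) \<in> forest_arcs V f" "(u, v) \<notin> parcs G" "f \<in> S"
        by (auto simp: S'_def)
      then have fa: "finite (forest_arcs V f)" and "u \<in> V"
        using finite_forest_arcs[OF fin(1)] by (auto simp: S_def rooted_forests_def forest_arcs_def)
      have "w u v = 0"
        using \<open>u \<in> V\<close> uv(2) assms(2) by (simp add: V_def)
      then have "\<exists>a\<in>forest_arcs V f. (case a of (u, v) \<Rightarrow> w u v) = 0"
        using uv(1) by (intro bexI[of _ "(u, v)"]) simp_all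
      with fa show "(\<Prod>(u, v)\<in>forest_arcs V f. w u v) = 0"
        by (rule prod_zero)
    qed
  qed (use fin in \<open>auto simp: S'_def\<close>)
  finally show ?thesis
    using prod by (simp add: S_def V_def)
qed

subsection \<open>Block constant perturbations and shifted Laplacians\<close>

lemma set_det_Plus_upper:
  fixes M :: "'a + 'i \<Rightarrow> 'a + 'i \<Rightarrow> 'b :: idom"
  assumes "finite V" "finite I" "\<And>u i. u \<in> V \<Longrightarrow> i \<in> I \<Longrightarrow> M (Inr i) (Inl u) = 0"
  shows "set_det (V <+> I) M =
    set_det V (\<lambda>u v. M (Inl u) (Inl v)) * set_det I (\<lambda>i j. M (Inr i) (Inr j))"
proof -
  have "set_det (V <+> I) M = set_det (Inl ` V) M * set_det (Inr ` I) M"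
    unfolding Plus_def using assms by (intro set_det_block_upper) auto
  then show ?thesis
    using assms(1,2) by (simp add: set_det_reindex)
qed

lemma set_det_Plus_lower:
  fixes M :: "'a + 'i \<Rightarrow> 'a + 'i \<Rightarrow> 'b :: idom"
  assumes "finite V" "finite I" "\<And>u i. u \<in> V \<Longrightarrow> i \<in> I \<Longrightarrow> M (Inl u) (Inr i) = 0"
  shows "set_det (V <+> I) M =
    set_det V (\<lambda>u v. M (Inl u) (Inl v)) * set_det I (\<lambda>i j. M (Inr i) (Inr j))"
proof -
  have "set_det (V <+> I) M = set_det (Inl ` V) M * set_det (Inr ` I) M"
    unfolding Plus_def using assms by (intro set_det_block_lower) auto
  then show ?thesis
    using assms(1,2) by (simp add: set_det_reindex)
qed

text \<open>A variant of the matrix determinant lemma. The row sum condition says that the indicator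
  vector of block \<open>j\<close> is an eigenvector of \<open>D\<close> for \<Delta> j, which
  reduces the perturbation to a matrix indexed by the blocks. The product of the \<Delta> i stands
  on the left because an integral domain has no division.\<close>

lemma set_det_add_block_constant:
  fixes D :: "'a \<Rightarrow> 'a \<Rightarrow> 'b :: idom" and \<pi> :: "'a \<Rightarrow> 'i"
  assumes fin: "finite V" "finite I" and \<pi>: "\<pi> ` V \<subseteq> I"
    and row_sum: "\<And>u j. u \<in> V \<Longrightarrow> j \<in> I \<Longrightarrow> (\<Sum>v\<in>{v \<in> V. \<pi> v = j}. D u v) = (if \<pi> u = j then \<Delta> j else 0)"
  shows "set_det V (\<lambda>u v. D u v + C (\<pi> u) (\<pi> v)) * (\<Prod>i\<in>I. \<Delta> i) =
    set_det V D * set_det I (\<lambda>i j. (if i = j then \<Delta> i else 0) + C i j * of_nat (card {v \<in> V. \<pi> v = j}))"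
proof -
  \<comment> \<open>With \<open>U\<close> the incidence matrix of \<open>V\<close> and the blocks \<open>I\<close>, evaluate the determinant of
    \<open>X = [[D, U], [- C U\<^sup>T, 1]]\<close> by multiplying with \<open>Y = [[1, 0], [C U\<^sup>T, 1]]\<close> and with
    \<open>Z = [[1, - U], [0, \<Delta>]]\<close>: both products are block triangular, the second because \<open>D U = U \<Delta>\<close>.\<close>
  define X where "X = case_sum (\<lambda>u. case_sum (D u) (\<lambda>j. if \<pi> u = j then 1 else 0))
    (\<lambda>i. case_sum (\<lambda>v. - C i (\<pi> v)) (\<lambda>j. if i = j then 1 else 0))"
  define Y where "Y = case_sum (\<lambda>u. case_sum (\<lambda>v. if u = v then 1 else 0) (\<lambda>j. 0))
    (\<lambda>i. case_sum (\<lambda>v. C i (\<pi> v)) (\<lambda>j. if i = j then 1 else (0 :: 'b)))"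
  define Z where "Z = case_sum (\<lambda>u. case_sum (\<lambda>v. if u = v then 1 else 0) (\<lambda>j. if \<pi> u = j then - 1 else 0))
    (\<lambda>i. case_sum (\<lambda>v. 0) (\<lambda>j. if i = j then \<Delta> i else (0 :: 'b)))"
  have \<pi>I: "\<pi> u \<in> I" if "u \<in> V" for u
    using \<pi> that by blast
  have sum_Plus: "(\<Sum>y\<in>V <+> I. f y) = (\<Sum>v\<in>V. f (Inl v)) + (\<Sum>i\<in>I. f (Inr i))" for f :: "'a + 'i \<Rightarrow> 'b"
    using fin by (simp add: sum.Plus comp_def)
  have ite: "x * (if P then 1 else 0) = (if P then x else (0 :: 'b))"
    "(if P then 1 else 0) * x = (if P then x else (0 :: 'b))"
    "x * (if P then - 1 else 0) = (if P then - x else (0 :: 'b))"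
    "x * (if P then y else 0) = (if P then x * y else (0 :: 'b))" for x y :: 'b and P
    by simp_all
  have block_sum: "(\<Sum>v\<in>V. if \<pi> v = j then g v else 0) = (\<Sum>v\<in>{v \<in> V. \<pi> v = j}. g v)" for j and g :: "'a \<Rightarrow> 'b"
    using fin(1) by (simp add: sum.inter_filter)
  have fin': "finite (V <+> I)"
    using fin by simp
  have diag: "set_det V (\<lambda>u v. if u = v then 1 else 0) = (1 :: 'b)"
    "set_det I (\<lambda>u v. if u = v then 1 else 0) = (1 :: 'b)"
    using fin by (simp_all add: set_det_diag)
  have "set_det V (\<lambda>u v. D u v + C (\<pi> u) (\<pi> v)) =
      set_det (V <+> I) (\<lambda>x z. \<Sum>y\<in>V <+> I. X x y * Y y z)"
  proof (subst set_det_Plus_upper[OF fin])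
    show "(\<Sum>y\<in>V <+> I. X (Inr i) y * Y y (Inl v)) = 0" if "v \<in> V" "i \<in> I" for v i
      unfolding sum_Plus X_def Y_def using that fin by (simp add: ite)
    have 1: "(\<Sum>y\<in>V <+> I. X (Inl u) y * Y y (Inl v)) = D u v + C (\<pi> u) (\<pi> v)" if "u \<in> V" "v \<in> V" for u v
      unfolding sum_Plus X_def Y_def using that fin \<pi>I by (simp add: ite)
    have 2: "(\<Sum>y\<in>V <+> I. X (Inr i) y * Y y (Inr j)) = (if i = j then 1 else 0)" if "i \<in> I" "j \<in> I" for i j
      unfolding sum_Plus X_def Y_def using that fin by (simp add: ite)
    show "set_det V (\<lambda>u v. D u v + C (\<pi> u) (\<pi> v)) =
        set_det V (\<lambda>u v. \<Sum>y\<in>V <+> I. X (Inl u) y * Y y (Inl v)) *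
        set_det I (\<lambda>i j. \<Sum>y\<in>V <+> I. X (Inr i) y * Y y (Inr j))"
      using set_det_cong[OF 1, of V] set_det_cong[OF 2, of I] diag by simp
  qed
  also have "\<dots> = set_det (V <+> I) X * set_det (V <+> I) Y"
    by (rule set_det_mult[OF fin'])
  also have "set_det (V <+> I) Y = 1"
    using set_det_Plus_lower[OF fin, of Y] diag by (simp add: Y_def)
  finally have left: "set_det V (\<lambda>u v. D u v + C (\<pi> u) (\<pi> v)) = set_det (V <+> I) X"
    by simp
  have "set_det (V <+> I) Z = (\<Prod>i\<in>I. \<Delta> i)"
    using set_det_Plus_upper[OF fin, of Z] diag fin by (simp add: Z_def set_det_diag)
  then have "set_det (V <+> I) X * (\<Prod>i\<in>I. \<Delta> i) =
      set_det (V <+> I) (\<lambda>x z. \<Sum>y\<in>V <+> I. X x y * Z y z)"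
    using set_det_mult[OF fin', of X Z] by simp
  also have "\<dots> = set_det V D *
      set_det I (\<lambda>i j. (if i = j then \<Delta> i else 0) + C i j * of_nat (card {v \<in> V. \<pi> v = j}))"
  proof (subst set_det_Plus_lower[OF fin])
    show "(\<Sum>y\<in>V <+> I. X (Inl u) y * Z y (Inr j)) = 0" if u: "u \<in> V" and j: "j \<in> I" for u j
    proof -
      have "(\<Sum>y\<in>V <+> I. X (Inl u) y * Z y (Inr j)) =
          - (\<Sum>v\<in>V. if \<pi> v = j then D u v else 0) + (\<Sum>i\<in>I. if \<pi> u = i then (if i = j then \<Delta> i else 0) else 0)"
        unfolding sum_Plus X_def Z_def sum_negf[symmetric]
        by (intro arg_cong2[where f = "(+)"] sum.cong refl) auto
      also have "\<dots> = 0"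
        unfolding block_sum row_sum[OF u j] using fin(2) \<pi>I[OF u] by (subst sum.delta') auto
      finally show ?thesis .
    qed
    have 1: "(\<Sum>y\<in>V <+> I. X (Inl u) y * Z y (Inl v)) = D u v" if "u \<in> V" "v \<in> V" for u v
      unfolding sum_Plus X_def Z_def using that fin by (simp add: ite)
    \<comment> \<open>The lower right block is C U^T U + \<Delta>, where U^T U is the diagonal
      matrix of block sizes.\<close>
    have 2: "(\<Sum>y\<in>V <+> I. X (Inr i) y * Z y (Inr j)) =
        (if i = j then \<Delta> i else 0) + C i j * of_nat (card {v \<in> V. \<pi> v = j})" if "i \<in> I" "j \<in> I" for i j
    proof -
      have "(\<Sum>y\<in>V <+> I. X (Inr i) y * Z y (Inr j)) =
          (\<Sum>v\<in>V. if \<pi> v = j then C i (\<pi> v) else 0) + (\<Sum>k\<in>I. if i = k then (if k = j then \<Delta> k else 0) else 0)"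
        unfolding sum_Plus X_def Z_def by (intro arg_cong2[where f = "(+)"] sum.cong refl) auto
      also have "(\<Sum>v\<in>V. if \<pi> v = j then C i (\<pi> v) else 0) = C i j * of_nat (card {v \<in> V. \<pi> v = j})"
        unfolding block_sum by simp
      also have "(\<Sum>k\<in>I. if i = k then (if k = j then \<Delta> k else 0) else 0) = (if i = j then \<Delta> i else 0)"
        using that fin(2) by (subst sum.delta') auto
      finally show ?thesis
        by simp
    qed
    show "set_det V (\<lambda>u v. \<Sum>y\<in>V <+> I. X (Inl u) y * Z y (Inl v)) *
        set_det I (\<lambda>i j. \<Sum>y\<in>V <+> I. X (Inr i) y * Z y (Inr j)) = set_det V D *
        set_det I (\<lambda>i j. (if i = j then \<Delta> i else 0) + C i j * of_nat (card {v \<in> V. \<pi> v = j}))"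
      using set_det_cong[OF 1, of V] set_det_cong[OF 2, of I] by simp
  qed
  finally show ?thesis
    using left by simp
qed

section \<open>Laplacians: characteristic polynomial, shifts and row sums\<close>

lemma vertex_enum:
  assumes "finite (pverts H)"
  shows "distinct (vertex_enum H)" "set (vertex_enum H) = pverts H"
    "length (vertex_enum H) = card (pverts H)"
proof -
  show *: "distinct (vertex_enum H)" "set (vertex_enum H) = pverts H"
    using someI_ex[of "\<lambda>vs. distinct vs \<and> set vs = pverts H"] finite_distinct_list[OF assms]
    unfolding vertex_enum_def by blast+
  show "length (vertex_enum H) = card (pverts H)"
    using distinct_card[OF *(1)] *(2) by simp
qed

text \<open>A monic complex polynomial is the product of its linear factors, taken with the orders
  of the roots. By hypothesis these orders count the indices with a given value of \<mu>, so the
  factors can be regrouped by index.\<close>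

lemma char_poly_laplacian:
  assumes "laplacian_eigenvalues H \<mu>"
  shows "char_poly (laplacian H) = (\<Prod>k = 1..card (pverts H). [:- \<mu> k, 1:])"
proof -
  define p where "p = char_poly (laplacian H)"
  define K where "K = {1..card (pverts H)}"
  have "laplacian H \<in> carrier_mat (card (pverts H)) (card (pverts H))"
    by (simp add: laplacian_def)
  from degree_monic_char_poly[OF this] have monic: "lead_coeff p = 1" "p \<noteq> 0"
    by (auto simp: p_def)
  have ord: "Polynomial.order z p = card {k \<in> K. \<mu> k = z}" for z
    using assms by (simp add: laplacian_eigenvalues_def p_def K_def)
  have roots: "{z. poly p z = 0} = \<mu> ` K"
    using monic(2) ord by (auto simp: order_root K_def)
  have "p = (\<Prod>z | poly p z = 0. [:- z, 1:] ^ Polynomial.order z p)"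
    using complex_poly_decompose[of p] monic(1) by simp
  also have "\<dots> = (\<Prod>z\<in>\<mu> ` K. \<Prod>k\<in>{k \<in> K. \<mu> k = z}. [:- \<mu> k, 1:])"
    unfolding roots ord by (intro prod.cong refl) simp
  also have "\<dots> = (\<Prod>k\<in>K. [:- \<mu> k, 1:])"
    by (rule prod.image_gen[symmetric]) (simp add: K_def)
  finally show ?thesis
    by (simp add: p_def K_def)
qed

text \<open>The shifted determinant is the characteristic polynomial at \<open>- x\<close> up to
  sign, and the sign \<open>(- 1) ^ n\<close> also comes out of the \<open>n\<close> linear
  factors.\<close>

lemma set_det_shifted_laplacian:
  assumes "finite (pverts H)" "laplacian_eigenvalues H \<mu>"
  shows "set_det (pverts H) (\<lambda>u v. (if u = v then x else 0) + laplacian_entry H u v) =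
    (\<Prod>k = 1..card (pverts H). \<mu> k + x)"
proof -
  define n where "n = card (pverts H)"
  define vs where "vs = vertex_enum H"
  have vs: "distinct vs" "set vs = pverts H" "length vs = n"
    using vertex_enum[OF assms(1)] by (simp_all add: vs_def n_def)
  define S where "S = mat n n (\<lambda>(a, b). (if vs ! a = vs ! b then x else 0) + laplacian_entry H (vs ! a) (vs ! b))"
  have L: "laplacian H \<in> carrier_mat n n"
    by (simp add: laplacian_def n_def)
  have "poly (char_poly (laplacian H)) (- x) = det (- char_matrix (laplacian H) (- x))"
    by (rule char_poly_matrix[OF L])
  also have "- char_matrix (laplacian H) (- x) = (- 1) \<cdot>\<^sub>m S"
    using vs(1,3) by (intro eq_matI)
      (auto simp: S_def char_matrix_def laplacian_def n_def vs_def nth_eq_iff_index_eq)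
  also have "det \<dots> = (- 1) ^ n * det S"
    by (simp add: S_def)
  also have "det S = set_det (pverts H) (\<lambda>u v. (if u = v then x else 0) + laplacian_entry H u v)"
    using det_mat_nth[OF vs(1), of "\<lambda>u v. (if u = v then x else 0) + laplacian_entry H u v"] vs(2,3)
    by (simp add: S_def)
  also have "poly (char_poly (laplacian H)) (- x) = (\<Prod>k = 1..n. (- 1) * (\<mu> k + x))"
    unfolding char_poly_laplacian[OF assms(2)] poly_prod n_def by (intro prod.cong) auto
  also have "\<dots> = (- 1) ^ n * (\<Prod>k = 1..n. \<mu> k + x)"
    by (simp only: prod.distrib) simp
  finally show ?thesis
    by (simp add: n_def)
qed

lemma out_degree_eq_sum:
  assumes "pair_digraph H"
  shows "of_nat (out_degree (with_proj H) u) = (\<Sum>v\<in>pverts H. of_bool ((u, v) \<in> parcs H) :: 'b :: semiring_1)"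
proof -
  interpret pair_digraph H by fact
  have "{e \<in> parcs H. fst e = u} = Pair u ` {v \<in> pverts H. (u, v) \<in> parcs H}"
    using in_arcsD2 by force
  then have "out_degree (with_proj H) u = card {v \<in> pverts H. (u, v) \<in> parcs H}"
    by (simp add: out_degree_def out_arcs_def card_image inj_on_def)
  then show ?thesis
    using pair_finite_verts by (simp add: sum.inter_filter[symmetric] of_bool_def)
qed

lemma laplacian_entry_row_sum:
  assumes "pair_digraph H" "u \<in> pverts H"
  shows "(\<Sum>v\<in>pverts H. laplacian_entry H u v) = 0"
proof -
  interpret pair_digraph H by fact
  have "(\<Sum>v\<in>pverts H. laplacian_entry H u v) =
      (\<Sum>v\<in>pverts H. (if u = v then of_nat (out_degree (with_proj H) u) else 0) - of_bool ((u, v) \<in> parcs H))"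
    \<comment> \<open>Without loops the adjacency indicator vanishes on the diagonal, so the entry
      splits without a case distinction.\<close>
    using pair_no_loops by (intro sum.cong) (fastforce simp: laplacian_entry_def)+
  also have "\<dots> = of_nat (out_degree (with_proj H) u) - (\<Sum>v\<in>pverts H. of_bool ((u, v) \<in> parcs H))"
    using assms(2) pair_finite_verts by (simp add: sum_subtractf)
  finally show ?thesis
    using out_degree_eq_sum[OF assms(1), of u, where 'b = complex] by simp
qed

subsection \<open>The generalized join\<close>

lemma generalized_join_simps:
  "pverts (generalized_join G H) = (SIGMA i : pverts G. pverts (H i))"
  "((i, u), (j, v)) \<in> parcs (generalized_join G H) \<longleftrightarrow>
    i \<in> pverts G \<and> j \<in> pverts G \<and> u \<in> pverts (H i) \<and> v \<in> pverts (H j) \<and>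
    (if i = j then (u, v) \<in> parcs (H i) else (i, j) \<in> parcs G)"
  by (auto simp: generalized_join_def)

lemma pair_digraph_generalized_join:
  assumes "pair_digraph G" "\<And>i. i \<in> pverts G \<Longrightarrow> pair_digraph (H i)"
  shows "pair_digraph (generalized_join G H)"
proof -
  have fin: "finite (SIGMA i : pverts G. pverts (H i))"
    using assms by (auto simp: pair_digraph_def pair_fin_digraph_def pair_fin_digraph_axioms_def)
  have loop: "(u, u) \<notin> parcs (H i)" if "i \<in> pverts G" for i u
    using pair_loopfree_digraph.pair_no_loops[of "H i" "(u, u)"] assms(2)[OF that]
    by (auto simp: pair_digraph_def)
  have "parcs (generalized_join G H) \<subseteq> pverts (generalized_join G H) \<times> pverts (generalized_join G H)"
    by (auto simp: generalized_join_simps)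
  then have "finite (parcs (generalized_join G H))"
    using fin by (auto simp: generalized_join_simps(1) intro: finite_subset)
  then show ?thesis
    using fin loop by unfold_locales (auto simp: generalized_join_simps split: if_splits)
qed

text \<open>The analogue of the theorem for forests, with root weights constant on blocks.
  Nonvanishing of the \<Delta> i permits cancelling their product; without root weights it fails for
  a vertex of outdegree 0 in \<open>G\<close>.\<close>

lemma forest_sum_generalized_join:
  fixes \<kappa> :: "'i \<Rightarrow> complex" and G :: "'i pair_pre_digraph" and H :: "'i \<Rightarrow> 'a pair_pre_digraph"
  defines "J \<equiv> generalized_join G H" and "m \<equiv> \<lambda>i. card (pverts (H i))"
  defines "\<Delta> \<equiv> \<lambda>i. \<kappa> i + of_nat (\<Sum>j | (i, j) \<in> parcs G. m j)"
  assumes G: "pair_digraph G" and H: "\<And>i. i \<in> pverts G \<Longrightarrow> nonempty_digraph (H i)"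
    and \<mu>: "\<And>i. i \<in> pverts G \<Longrightarrow> laplacian_eigenvalues (H i) (\<mu> i)"
    and nz: "\<And>i. i \<in> pverts G \<Longrightarrow> \<Delta> i \<noteq> 0"
  shows "(\<Sum>f\<in>rooted_forests (pverts J). \<Prod>x\<in>pverts J.
      forest_weight (\<lambda>x. \<kappa> (fst x)) (\<lambda>x y. of_bool ((x, y) \<in> parcs J)) f x) =
    (\<Prod>i\<in>pverts G. \<Prod>k = 1..m i - 1. \<mu> i k + \<Delta> i) *
    (\<Sum>f\<in>rooted_forests (pverts G). \<Prod>i\<in>pverts G.
      forest_weight \<kappa> (\<lambda>i j. of_bool ((i, j) \<in> parcs G) * of_nat (m j)) f i)"
proof -
  interpret G: pair_digraph G by fact
  define I where "I = pverts G"
  define V where "V = (SIGMA i : I. pverts (H i))"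
  have H': "pair_digraph (H i)" "pverts (H i) \<noteq> {}" if "i \<in> I" for i
    using H that by (auto simp: I_def nonempty_digraph_def)
  have finI: "finite I"
    using G.pair_finite_verts by (simp add: I_def)
  have finH: "finite (pverts (H i))" if "i \<in> I" for i
    using H'(1)[OF that] by (simp add: pair_digraph_def pair_fin_digraph_def pair_fin_digraph_axioms_def)
  have finV: "finite V"
    using finI finH by (simp add: V_def)
  have loopG: "(i, i) \<notin> parcs G" for i
    using G.pair_no_loops by fastforce
  have loopH: "(u, u) \<notin> parcs (H i)" if "i \<in> I" for i u
    using pair_loopfree_digraph.pair_no_loops[of "H i" "(u, u)"] H'(1)[OF that]
    by (auto simp: pair_digraph_def)
  have J: "pverts J = V"
    by (simp add: J_def V_def I_def generalized_join_simps)
  have arcJ: "((i, u), (j, v)) \<in> parcs J \<longleftrightarrow> (if i = j then (u, v) \<in> parcs (H i) else (i, j) \<in> parcs G)"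
    if "(i, u) \<in> V" "(j, v) \<in> V" for i j u v
    using that by (auto simp: J_def V_def I_def generalized_join_simps)
  have degG: "(\<Sum>j\<in>I. of_bool ((i, j) \<in> parcs G) * of_nat (m j)) = (of_nat (\<Sum>j | (i, j) \<in> parcs G. m j) :: complex)"
    for i
  proof -
    have "(\<Sum>j\<in>I. of_bool ((i, j) \<in> parcs G) * of_nat (m j)) =
        (\<Sum>j\<in>I. if (i, j) \<in> parcs G then of_nat (m j) else (0 :: complex))"
      by (intro sum.cong refl) simp
    also have "\<dots> = (\<Sum>j\<in>{j \<in> I. (i, j) \<in> parcs G}. of_nat (m j))"
      by (rule sum.inter_filter[OF finI, symmetric])
    also have "{j \<in> I. (i, j) \<in> parcs G} = {j. (i, j) \<in> parcs G}"
      using G.in_arcsD2 by (auto simp: I_def)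
    finally show ?thesis
      by simp
  qed
  \<comment> \<open>\<open>C\<close> carries the arcs between different blocks and is 0 on the
    diagonal since \<open>G\<close> has no loops; \<open>D\<close> is the block diagonal
    remainder.\<close>
  define C where "C i j = - (of_bool ((i, j) \<in> parcs G) :: complex)" for i j
  define D where "D x y = (if fst x = fst y then
      (if snd x = snd y then \<Delta> (fst x) else 0) + laplacian_entry (H (fst x)) (snd x) (snd y) else 0)" for x y
  define w where "w x y = (of_bool ((x, y) \<in> parcs J) :: complex)" for x y
  \<comment> \<open>Besides its arcs inside block \<open>i\<close>, the vertex has
    \<open>m j\<close> arcs into each block \<open>j\<close> with an arc from \<open>i\<close> to
    \<open>j\<close>. This second number does not depend on \<open>u\<close> and becomes part of the
    shift \<Delta> i.\<close>
  have out: "(\<Sum>y\<in>V. w (i, u) y) =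
      of_nat (out_degree (with_proj (H i)) u) + of_nat (\<Sum>j | (i, j) \<in> parcs G. m j)" if iu: "(i, u) \<in> V" for i u
  proof -
    have i: "i \<in> I" and u: "u \<in> pverts (H i)"
      using iu by (auto simp: V_def)
    have "(\<Sum>y\<in>V. w (i, u) y) = (\<Sum>j\<in>I. \<Sum>v\<in>pverts (H j). w (i, u) (j, v))"
      unfolding V_def using finI finH by (subst sum.Sigma) (auto simp: split_def)
    also have "\<dots> = (\<Sum>j\<in>I. (if i = j then of_nat (out_degree (with_proj (H i)) u) else 0) +
        of_bool ((i, j) \<in> parcs G) * of_nat (m j))"
    proof (intro sum.cong refl)
      fix j assume j: "j \<in> I"
      show "(\<Sum>v\<in>pverts (H j). w (i, u) (j, v)) =
          (if i = j then of_nat (out_degree (with_proj (H i)) u) else 0) + of_bool ((i, j) \<in> parcs G) * of_nat (m j)"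
      proof (cases "i = j")
        case True
        have "(\<Sum>v\<in>pverts (H j). w (i, u) (j, v)) = (\<Sum>v\<in>pverts (H i). of_bool ((u, v) \<in> parcs (H i)))"
          unfolding True w_def using iu True j by (intro sum.cong refl) (simp add: arcJ V_def)
        then show ?thesis
          using True loopG out_degree_eq_sum[OF H'(1)[OF i], of u, where 'b = complex] by simp
      next
        case False
        have "(\<Sum>v\<in>pverts (H j). w (i, u) (j, v)) = (\<Sum>v\<in>pverts (H j). of_bool ((i, j) \<in> parcs G))"
          unfolding w_def using iu False j by (intro sum.cong refl) (simp add: arcJ V_def)
        then show ?thesis
          using False by (simp add: m_def)
      qed
    qed
    also have "\<dots> = of_nat (out_degree (with_proj (H i)) u) + of_nat (\<Sum>j | (i, j) \<in> parcs G. m j)"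
      using i finI by (simp only: sum.distrib degG) simp
    finally show ?thesis .
  qed
  have entry: "(if x = y then \<kappa> (fst x) + (\<Sum>z\<in>V. w x z) else 0) - w x y = D x y + C (fst x) (fst y)"
    if "x \<in> V" "y \<in> V" for x y
  proof -
    obtain i u j v where xy: "x = (i, u)" "y = (j, v)"
      by (cases x, cases y)
    have i: "i \<in> I"
      using that by (auto simp: V_def xy)
    show ?thesis
      using that i out[of i u] arcJ[of i u j v] loopG loopH[of i]
      unfolding xy by (auto simp: D_def C_def w_def \<Delta>_def laplacian_entry_def)
  qed
  have block: "{y \<in> V. fst y = j} = Pair j ` pverts (H j)" if "j \<in> I" for j
    using that by (auto simp: V_def)
  have card_block: "card {y \<in> V. fst y = j} = m j" if "j \<in> I" for j
    unfolding block[OF that] m_def by (simp add: card_image inj_on_def)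
  \<comment> \<open>Rows of the Laplacian of a block sum to 0, so only the shift is left.\<close>
  have row_sum: "(\<Sum>y\<in>{y \<in> V. fst y = j}. D x y) = (if fst x = j then \<Delta> j else 0)" if x: "x \<in> V" and j: "j \<in> I" for x j
  proof -
    have "(\<Sum>y\<in>{y \<in> V. fst y = j}. D x y) = (\<Sum>v\<in>pverts (H j). D x (j, v))"
      unfolding block[OF j] by (simp add: sum.reindex inj_on_def)
    also have "\<dots> = (if fst x = j then \<Delta> j else 0)"
    proof (cases "fst x = j")
      case True
      then have "snd x \<in> pverts (H j)"
        using x by (auto simp: V_def)
      then show ?thesis
        using True finH[OF j] laplacian_entry_row_sum[OF H'(1)[OF j]] by (simp add: D_def sum.distrib)
    qed (simp add: D_def)
    finally show ?thesis .
  qed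
  have "set_det V D = (\<Prod>i\<in>I. set_det (pverts (H i)) (\<lambda>u v. D (i, u) (i, v)))"
    unfolding V_def using finI finH by (intro set_det_Sigma) (auto simp: D_def)
  also have "\<dots> = (\<Prod>i\<in>I. \<Delta> i * (\<Prod>k = 1..m i - 1. \<mu> i k + \<Delta> i))"
  proof (intro prod.cong refl)
    fix i assume i: "i \<in> I"
    have "D (i, u) (i, v) = (if u = v then \<Delta> i else 0) + laplacian_entry (H i) u v" for u v
      by (simp add: D_def)
    then have "set_det (pverts (H i)) (\<lambda>u v. D (i, u) (i, v)) = (\<Prod>k = 1..m i. \<mu> i k + \<Delta> i)"
      using set_det_shifted_laplacian[OF finH[OF i] \<mu>, of "\<Delta> i"] i by (simp add: I_def m_def)
    \<comment> \<open>Since blocks are nonempty, the last factor can be split off. Its eigenvalue is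
      0, so the factor is \<Delta> i.\<close>
    also have "m i = Suc (m i - 1)"
      using finH[OF i] H'(2)[OF i] by (simp add: m_def card_gt_0_iff)
    also have "(\<Prod>k = 1..Suc (m i - 1). \<mu> i k + \<Delta> i) =
        (\<mu> i (Suc (m i - 1)) + \<Delta> i) * (\<Prod>k = 1..m i - 1. \<mu> i k + \<Delta> i)"
      by (rule prod.nat_ivl_Suc') simp
    also have "\<mu> i (Suc (m i - 1)) = 0"
      using \<mu>[of i] i \<open>m i = Suc (m i - 1)\<close> by (simp add: laplacian_eigenvalues_def I_def m_def)
    finally show "set_det (pverts (H i)) (\<lambda>u v. D (i, u) (i, v)) = \<Delta> i * (\<Prod>k = 1..m i - 1. \<mu> i k + \<Delta> i)"
      by simp
  qed
  finally have detD: "set_det V D = (\<Prod>i\<in>I. \<Delta> i) * (\<Prod>i\<in>I. \<Prod>k = 1..m i - 1. \<mu> i k + \<Delta> i)"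
    by (simp add: prod.distrib)
  have lhs: "(\<Sum>f\<in>rooted_forests V. \<Prod>x\<in>V. forest_weight (\<lambda>x. \<kappa> (fst x)) w f x) =
      set_det V (\<lambda>x y. D x y + C (fst x) (fst y))"
    unfolding matrix_forest[OF finV, symmetric] by (rule set_det_cong) (rule entry)
  \<comment> \<open>The block size multiplying column \<open>j\<close> is exactly the weight
    \<open>m j\<close> of an arc of \<open>G\<close> with head \<open>j\<close>.\<close>
  have rhs: "(\<Sum>f\<in>rooted_forests I. \<Prod>i\<in>I. forest_weight \<kappa> (\<lambda>i j. of_bool ((i, j) \<in> parcs G) * of_nat (m j)) f i) =
      set_det I (\<lambda>i j. (if i = j then \<Delta> i else 0) + C i j * of_nat (card {y \<in> V. fst y = j}))"
    unfolding matrix_forest[OF finI, symmetric]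
    by (rule set_det_cong) (auto simp: degG \<Delta>_def C_def card_block)
  have "set_det V (\<lambda>x y. D x y + C (fst x) (fst y)) * (\<Prod>i\<in>I. \<Delta> i) = set_det V D *
      set_det I (\<lambda>i j. (if i = j then \<Delta> i else 0) + C i j * of_nat (card {y \<in> V. fst y = j}))"
    using finV finI row_sum by (intro set_det_add_block_constant) (auto simp: V_def)
  moreover have "(\<Prod>i\<in>I. \<Delta> i) \<noteq> 0"
    using finI nz by (simp add: I_def)
  ultimately have "(\<Sum>f\<in>rooted_forests V. \<Prod>x\<in>V. forest_weight (\<lambda>x. \<kappa> (fst x)) w f x) =
      (\<Prod>i\<in>I. \<Prod>k = 1..m i - 1. \<mu> i k + \<Delta> i) *
      (\<Sum>f\<in>rooted_forests I. \<Prod>i\<in>I. forest_weight \<kappa> (\<lambda>i j. of_bool ((i, j) \<in> parcs G) * of_nat (m j)) f i)"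
    unfolding lhs rhs detD by (simp add: mult_ac)
  then show ?thesis
    unfolding J w_def I_def .
qed

section \<open>From forests to trees: passage to the limit\<close>

theorem theorem4p2:
  fixes n :: nat
    and G :: "nat pair_pre_digraph"
    and H :: "nat \<Rightarrow> 'a pair_pre_digraph"
    and m :: "nat \<Rightarrow> nat"
    and \<mu> :: "nat \<Rightarrow> nat \<Rightarrow> complex"
    and i\<^sub>0 :: nat
  assumes "nonempty_digraph G"
    and "pverts G = {1..n}"
    and "\<And>i. i \<in> {1..n} \<Longrightarrow> nonempty_digraph (H i)"
    and "\<And>i. i \<in> {1..n} \<Longrightarrow> card (pverts (H i)) = m i"
    and "\<And>i. i \<in> {1..n} \<Longrightarrow> laplacian_eigenvalues (H i) (\<mu> i)"
    and "i\<^sub>0 \<in> pverts G"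
  shows "of_nat (\<Sum>u \<in> pverts (H i\<^sub>0). num_oriented_spanning_trees (generalized_join G H) (i\<^sub>0, u)) =
    (\<Prod>i \<in> pverts G. \<Prod>k = 1..m i - 1. (\<mu> i k + of_nat (\<Sum>j | (i, j) \<in> parcs G. m j))) *
    of_nat (\<Sum>T \<in> oriented_spanning_trees G i\<^sub>0. \<Prod>(i, j) \<in> parcs T. m j)"
proof -
  define J where "J = generalized_join G H"
  define I where "I = pverts G"
  have G: "pair_digraph G"
    using assms(1) by (simp add: nonempty_digraph_def)
  interpret G: pair_digraph G by (rule G)
  have H: "nonempty_digraph (H i)" "card (pverts (H i)) = m i" "laplacian_eigenvalues (H i) (\<mu> i)" if "i \<in> I" for i
    using assms(2-5) that by (auto simp: I_def)
  have J: "pair_digraph J"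
    unfolding J_def using G H(1) by (intro pair_digraph_generalized_join) (auto simp: I_def nonempty_digraph_def)
  interpret J: pair_digraph J by (rule J)
  have pJ: "pverts J = (SIGMA i : I. pverts (H i))"
    by (simp add: J_def I_def generalized_join_simps)
  have finH: "finite (pverts (H i))" "pverts (H i) \<noteq> {}" if "i \<in> I" for i
    using H(1)[OF that]
    by (auto simp: nonempty_digraph_def pair_digraph_def pair_fin_digraph_def pair_fin_digraph_axioms_def)
  have finI: "finite I" and i0: "i\<^sub>0 \<in> I"
    using G.pair_finite_verts assms(6) by (simp_all add: I_def)
  \<comment> \<open>\<open>m\<close> is prescribed only on the vertices of \<open>G\<close>, which
    suffices because heads of arcs are vertices.\<close>
  have out: "(\<Sum>j | (i, j) \<in> parcs G. card (pverts (H j))) = (\<Sum>j | (i, j) \<in> parcs G. m j)" for i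
    by (intro sum.cong refl H(2)) (auto simp: I_def dest: G.in_arcsD2)
  define d where "d i = (\<Sum>j | (i, j) \<in> parcs G. m j)" for i
  define s where "s n = (of_real (inverse (real (Suc n))) :: complex)" for n
  define \<kappa> where "\<kappa> n i = (if i = i\<^sub>0 then s n else (s n)\<^sup>2)" for n i
  define wJ where "wJ x y = (of_bool ((x, y) \<in> parcs J) :: complex)" for x y
  define wG where "wG i j = (of_bool ((i, j) \<in> parcs G) * of_nat (m j) :: complex)" for i j
  have s0: "s \<longlonglongrightarrow> 0"
    unfolding s_def using tendsto_of_real[OF LIMSEQ_inverse_real_of_nat, where 'a = complex] by simp
  have s_nz: "s n \<noteq> 0" for n
    by (simp add: s_def del: of_nat_Suc)
  have \<kappa>0: "(\<lambda>n. \<kappa> n i) \<longlonglongrightarrow> 0" for i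
    using s0 tendsto_power[OF s0, of 2] by (cases "i = i\<^sub>0") (simp_all add: \<kappa>_def)
  \<comment> \<open>The quotient is 1 at \<open>i\<^sub>0\<close> and \<open>s n\<close> elsewhere,
    so the limit selects the roots in block \<open>i\<^sub>0\<close>.\<close>
  have \<kappa>1: "(\<lambda>n. \<kappa> n i / s n) \<longlonglongrightarrow> of_bool (i = i\<^sub>0)" for i
    using s0 s_nz by (cases "i = i\<^sub>0") (simp_all add: \<kappa>_def power2_eq_square)
  \<comment> \<open>The complex number is the image of a positive real: the root weight is positive
    and \<open>d i\<close> is nonnegative.\<close>
  have nz: "\<kappa> n i + of_nat (d i) \<noteq> 0" for n i
  proof -
    have "\<kappa> n i + of_nat (d i) =
        of_real ((if i = i\<^sub>0 then inverse (real (Suc n)) else (inverse (real (Suc n)))\<^sup>2) + real (d i))"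
      by (simp add: \<kappa>_def s_def)
    moreover have "(if i = i\<^sub>0 then inverse (real (Suc n)) else (inverse (real (Suc n)))\<^sup>2) + real (d i) > 0"
      by (intro add_pos_nonneg) (simp_all del: of_nat_Suc)
    ultimately show ?thesis
      by (metis less_irrefl of_real_eq_0_iff)
  qed
  have forests: "(\<Sum>f\<in>rooted_forests (pverts J). \<Prod>x\<in>pverts J. forest_weight (\<lambda>x. \<kappa> n (fst x)) wJ f x) / s n =
      (\<Prod>i\<in>I. \<Prod>k = 1..m i - 1. \<mu> i k + (\<kappa> n i + of_nat (d i))) *
      ((\<Sum>f\<in>rooted_forests I. \<Prod>i\<in>I. forest_weight (\<kappa> n) wG f i) / s n)" for n
  proof -
    have "(\<Sum>f\<in>rooted_forests (pverts J). \<Prod>x\<in>pverts J. forest_weight (\<lambda>x. \<kappa> n (fst x)) wJ f x) =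
        (\<Prod>i\<in>I. \<Prod>k = 1..card (pverts (H i)) - 1. \<mu> i k + (\<kappa> n i + of_nat (d i))) *
        (\<Sum>f\<in>rooted_forests I. \<Prod>i\<in>I.
          forest_weight (\<kappa> n) (\<lambda>i j. of_bool ((i, j) \<in> parcs G) * of_nat (card (pverts (H j)))) f i)"
      using forest_sum_generalized_join[OF G, of H \<mu> "\<kappa> n"] H(1,3) nz
      unfolding J_def I_def wJ_def out d_def by auto
    also have "(\<Prod>i\<in>I. \<Prod>k = 1..card (pverts (H i)) - 1. \<mu> i k + (\<kappa> n i + of_nat (d i))) =
        (\<Prod>i\<in>I. \<Prod>k = 1..m i - 1. \<mu> i k + (\<kappa> n i + of_nat (d i)))"
      by (intro prod.cong refl) (simp add: H(2))
    \<comment> \<open>This is an equality of functions on all arguments: off the arcs both sides are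
      0, and the head of an arc lies in \<open>I\<close>.\<close>
    also have "(\<lambda>i j. of_bool ((i, j) \<in> parcs G) * of_nat (card (pverts (H j)))) = wG"
      unfolding wG_def fun_eq_iff using G.in_arcsD2 H(2) by (auto simp: I_def)
    finally show ?thesis
      by simp
  qed
  have neJ: "pverts J \<noteq> {}" and neI: "I \<noteq> {}"
    using i0 finH(2)[OF i0] by (auto simp: pJ)
  have limJ: "(\<lambda>n. (\<Sum>f\<in>rooted_forests (pverts J). \<Prod>x\<in>pverts J. forest_weight (\<lambda>x. \<kappa> n (fst x)) wJ f x) / s n)
      \<longlonglongrightarrow> (\<Sum>x\<in>pverts J. of_bool (fst x = i\<^sub>0) * (\<Sum>T\<in>oriented_spanning_trees J x. \<Prod>(u, v)\<in>parcs T. wJ u v))"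
  proof -
    have sum_J: "(\<Sum>T\<in>oriented_spanning_trees J x. \<Prod>(u, v)\<in>parcs T. wJ u v) =
        (\<Sum>f\<in>{f \<in> rooted_forests (pverts J). forest_roots (pverts J) f = {x}}.
          \<Prod>v\<in>pverts J - {x}. wJ v (the (f v)))" for x
      by (rule sum_oriented_spanning_trees[OF J]) (simp add: wJ_def)
    show ?thesis
      unfolding sum_J by (rule tendsto_forest_sum[OF J.pair_finite_verts neJ \<kappa>0 \<kappa>1])
  qed
  have limG: "(\<lambda>n. (\<Sum>f\<in>rooted_forests I. \<Prod>i\<in>I. forest_weight (\<kappa> n) wG f i) / s n)
      \<longlonglongrightarrow> (\<Sum>i\<in>I. of_bool (i = i\<^sub>0) * (\<Sum>T\<in>oriented_spanning_trees G i. \<Prod>(u, v)\<in>parcs T. wG u v))"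
  proof -
    have sum_G: "(\<Sum>T\<in>oriented_spanning_trees G i. \<Prod>(u, v)\<in>parcs T. wG u v) =
        (\<Sum>f\<in>{f \<in> rooted_forests I. forest_roots I f = {i}}. \<Prod>v\<in>I - {i}. wG v (the (f v)))" for i
      unfolding I_def by (rule sum_oriented_spanning_trees[OF G]) (simp add: wG_def)
    show ?thesis
      unfolding sum_G by (rule tendsto_forest_sum[OF finI neI \<kappa>0 \<kappa>1])
  qed
  \<comment> \<open>The limit keeps \<open>0 +\<close> because the sum of limits has this
    shape.\<close>
  have limP: "(\<lambda>n. \<Prod>i\<in>I. \<Prod>k = 1..m i - 1. \<mu> i k + (\<kappa> n i + of_nat (d i)))
      \<longlonglongrightarrow> (\<Prod>i\<in>I. \<Prod>k = 1..m i - 1. \<mu> i k + (0 + of_nat (d i)))"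
    by (intro tendsto_intros \<kappa>0)
  have treesJ: "(\<Sum>T\<in>oriented_spanning_trees J x. \<Prod>(u, v)\<in>parcs T. wJ u v) =
      of_nat (num_oriented_spanning_trees J x)" for x
  proof -
    have "(\<Sum>T\<in>oriented_spanning_trees J x. \<Prod>(u, v)\<in>parcs T. wJ u v) = (\<Sum>T\<in>oriented_spanning_trees J x. 1)"
      by (intro sum.cong refl prod.neutral) (auto simp: wJ_def dest: parcs_oriented_spanning_tree)
    then show ?thesis
      by (simp add: num_oriented_spanning_trees_def)
  qed
  have treesG: "(\<Sum>T\<in>oriented_spanning_trees G i. \<Prod>(u, v)\<in>parcs T. wG u v) =
      of_nat (\<Sum>T\<in>oriented_spanning_trees G i. \<Prod>(u, v)\<in>parcs T. m v)" for i
    unfolding of_nat_sum of_nat_prod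
    by (intro sum.cong prod.cong refl) (auto simp: wG_def dest: parcs_oriented_spanning_tree)
  \<comment> \<open>Summing block by block, the indicator leaves only the trees rooted in block
    \<open>i\<^sub>0\<close>.\<close>
  have "(\<Sum>x\<in>pverts J. of_bool (fst x = i\<^sub>0) * of_nat (num_oriented_spanning_trees J x)) =
      (\<Sum>i\<in>I. \<Sum>u\<in>pverts (H i). of_bool (i = i\<^sub>0) * (of_nat (num_oriented_spanning_trees J (i, u)) :: complex))"
    unfolding pJ using finI finH(1) by (subst sum.Sigma) (auto simp: split_def)
  also have "\<dots> = (\<Sum>i\<in>I. if i = i\<^sub>0 then of_nat (\<Sum>u\<in>pverts (H i). num_oriented_spanning_trees J (i, u)) else 0)"
    by (intro sum.cong refl) simp
  also have "\<dots> = of_nat (\<Sum>u\<in>pverts (H i\<^sub>0). num_oriented_spanning_trees J (i\<^sub>0, u))"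
    using finI i0 by simp
  \<comment> \<open>By \<open>forests\<close> the two sides are limits of the same sequence.\<close>
  finally have "of_nat (\<Sum>u\<in>pverts (H i\<^sub>0). num_oriented_spanning_trees J (i\<^sub>0, u)) =
      (\<Prod>i\<in>I. \<Prod>k = 1..m i - 1. \<mu> i k + (0 + of_nat (d i))) *
      (\<Sum>i\<in>I. of_bool (i = i\<^sub>0) * of_nat (\<Sum>T\<in>oriented_spanning_trees G i. \<Prod>(u, v)\<in>parcs T. m v))"
    using LIMSEQ_unique[OF limJ[unfolded forests treesJ] tendsto_mult[OF limP limG[unfolded treesG]]] by simp
  also have "(\<Sum>i\<in>I. of_bool (i = i\<^sub>0) * of_nat (\<Sum>T\<in>oriented_spanning_trees G i. \<Prod>(u, v)\<in>parcs T. m v)) =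
      (\<Sum>i\<in>I. if i = i\<^sub>0 then of_nat (\<Sum>T\<in>oriented_spanning_trees G i. \<Prod>(u, v)\<in>parcs T. m v) else (0 :: complex))"
    by (intro sum.cong refl) simp
  also have "\<dots> = of_nat (\<Sum>T\<in>oriented_spanning_trees G i\<^sub>0. \<Prod>(u, v)\<in>parcs T. m v)"
    using finI i0 by simp
  finally show ?thesis
    by (simp add: J_def I_def d_def)
qed

end
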